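(* Let $G$ be a transposable finite group with transpose group $G^{T}$. Then for all $i\geq 1$ the (abelian) factors $Z_{i}(G)/Z_{i-1}(G)$ and $\gamma_{i}(G^{T})/\gamma_{i+1}(G^{T})$ are isomorphic.
   Context: All groups are finite. A group $G$ with complex character table $X$ (rows indexed by irreducible characters, columns by conjugacy classes) is called transposable if there exist non-negative integer diagonal matrices $D$ and $N$ such that $\tilde X=(D^{-1}XN)^{T}$ is the character table (in a suitable ordering of rows and columns) of some finite group $G^{T}$, called a transpose group of $G$. Here $D$ is the diagonal matrix of the character degrees of $G$, and $N$ is the diagonal matrix of the character degrees of $G^T$. The upper central series is $Z_0(H)=1$, $Z_i(H)/Z_{i-1}(H)=Z(H/Z_{i-1}(H))$; the lower central series is $\gamma_1(H)=H$, $\gamma_i(H)=[\gamma_{i-1}(H),H]$. *)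

theory Defs
  imports "HOL-Algebra.Group_Action" "HOL-Algebra.Generated_Groups"
    "Jordan_Normal_Form.Matrix" "Jordan_Normal_Form.VS_Connect"
begin

section \<open>Complex characters of finite groups\<close>

definition GL_complex :: "nat \<Rightarrow> complex mat monoid" where
  "GL_complex n = units_of (ring_mat TYPE(complex) n ())"

definition representation ::
  "('a, 'm) monoid_scheme \<Rightarrow> nat \<Rightarrow> ('a \<Rightarrow> complex mat) \<Rightarrow> bool" where
  "representation G n \<rho> \<longleftrightarrow> \<rho> \<in> hom G (GL_complex n)"

definition invariant_subspace ::
  "('a, 'm) monoid_scheme \<Rightarrow> nat \<Rightarrow> ('a \<Rightarrow> complex mat) \<Rightarrow> complex vec set \<Rightarrow> bool" where
  "invariant_subspace G n \<rho> W \<longleftrightarrow>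
     subspace class_ring W (module_vec TYPE(complex) n) \<and>
     (\<forall>g\<in>carrier G. \<forall>w\<in>W. \<rho> g *\<^sub>v w \<in> W)"

definition irreducible_representation ::
  "('a, 'm) monoid_scheme \<Rightarrow> nat \<Rightarrow> ('a \<Rightarrow> complex mat) \<Rightarrow> bool" where
  "irreducible_representation G n \<rho> \<longleftrightarrow>
     representation G n \<rho> \<and> n > 0 \<and>
     (\<forall>W. invariant_subspace G n \<rho> W \<longrightarrow> W = {0\<^sub>v n} \<or> W = carrier_vec n)"

definition mat_trace :: "complex mat \<Rightarrow> complex" where
  "mat_trace A = (\<Sum>i<dim_row A. A $$ (i, i))"

text \<open>Characters are restricted to the carrier (\<^const>\<open>undefined\<close> elsewhere), so that distinct
  elements of the following set are distinct characters of the group.\<close>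

definition irreducible_characters :: "('a, 'm) monoid_scheme \<Rightarrow> ('a \<Rightarrow> complex) set" where
  "irreducible_characters G =
     {restrict (\<lambda>g. mat_trace (\<rho> g)) (carrier G) | \<rho> n. irreducible_representation G n \<rho>}"

definition conjugacy_classes :: "('a, 'm) monoid_scheme \<Rightarrow> 'a set set" where
  "conjugacy_classes G =
     orbits G (carrier G) (\<lambda>g. \<lambda>h\<in>carrier G. g \<otimes>\<^bsub>G\<^esub> h \<otimes>\<^bsub>G\<^esub> inv\<^bsub>G\<^esub> g)"

text \<open>\<open>X\<close> is the character table of \<open>G\<close> whose rows are ordered by the list \<open>\<chi>s\<close> of
  irreducible characters and whose columns are ordered by the list \<open>Cs\<close> of conjugacy classes.\<close>

definition character_table ::
  "('a, 'm) monoid_scheme \<Rightarrow> ('a \<Rightarrow> complex) list \<Rightarrow> 'a set list \<Rightarrow> complex mat \<Rightarrow> bool" where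
  "character_table G \<chi>s Cs X \<longleftrightarrow>
     distinct \<chi>s \<and> set \<chi>s = irreducible_characters G \<and>
     distinct Cs \<and> set Cs = conjugacy_classes G \<and>
     X \<in> carrier_mat (length \<chi>s) (length Cs) \<and>
     (\<forall>i<length \<chi>s. \<forall>j<length Cs. \<forall>g\<in>Cs ! j. X $$ (i, j) = (\<chi>s ! i) g)"


section \<open>Transposable groups\<close>

text \<open>The non-negative integer diagonal matrices are given by their diagonals
  \<open>d, n :: nat \<Rightarrow> nat\<close>. The sizes of \<open>D\<close> and \<open>N\<close> are the ones for which the product is defined;
  the equation for \<open>Y\<close> then forces \<open>Y\<close> to have \<open>dim_col X\<close> rows, so that the rows of \<open>Y\<close>
  correspond to the diagonal entries of \<open>N\<close>.\<close>

definition is_transpose_group ::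
  "('a, 'm) monoid_scheme \<Rightarrow> ('b, 'k) monoid_scheme \<Rightarrow> bool" where
  "is_transpose_group G H \<longleftrightarrow>
     group H \<and> finite (carrier H) \<and>
     (\<exists>\<chi>s Cs X \<psi>s Ks Y d n.
        let M = ring_mat TYPE(complex) (dim_row X) ();
            D = mat_diag (dim_row X) (\<lambda>i. of_nat (d i));
            N = mat_diag (dim_col X) (\<lambda>j. of_nat (n j))
        in character_table G \<chi>s Cs X \<and> character_table H \<psi>s Ks Y \<and>
           (\<forall>i<length \<chi>s. of_nat (d i) = (\<chi>s ! i) \<one>\<^bsub>G\<^esub>) \<and>
           (\<forall>j<length \<psi>s. of_nat (n j) = (\<psi>s ! j) \<one>\<^bsub>H\<^esub>) \<and>
           D \<in> Units M \<and>
           Y = transpose_mat (inv\<^bsub>M\<^esub> D * X * N))"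

text \<open>Quantifying over groups with carrier in \<^typ>\<open>nat\<close> is no restriction, since every finite
  group is isomorphic to one of these and isomorphic groups have the same character tables.\<close>

definition transposable :: "('a, 'm) monoid_scheme \<Rightarrow> bool" where
  "transposable G \<longleftrightarrow> (\<exists>H :: nat monoid. is_transpose_group G H)"


section \<open>Central series\<close>

definition group_center :: "('a, 'm) monoid_scheme \<Rightarrow> 'a set" where
  "group_center G = {z \<in> carrier G. \<forall>g\<in>carrier G. z \<otimes>\<^bsub>G\<^esub> g = g \<otimes>\<^bsub>G\<^esub> z}"

text \<open>The successor step is the full preimage of the center of \<open>G / Z\<^sub>i\<close>, that is, the unique
  subgroup \<open>Z\<^sub>i\<^sub>+\<^sub>1\<close> of \<open>G\<close> containing \<open>Z\<^sub>i\<close> with \<open>Z\<^sub>i\<^sub>+\<^sub>1 / Z\<^sub>i = Z(G / Z\<^sub>i)\<close>.\<close>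

fun upper_central :: "('a, 'm) monoid_scheme \<Rightarrow> nat \<Rightarrow> 'a set" where
  "upper_central G 0 = {\<one>\<^bsub>G\<^esub>}"
| "upper_central G (Suc i) =
     {x \<in> carrier G. upper_central G i #>\<^bsub>G\<^esub> x \<in> group_center (G Mod upper_central G i)}"

definition commutator_subgroup :: "('a, 'm) monoid_scheme \<Rightarrow> 'a set \<Rightarrow> 'a set \<Rightarrow> 'a set" where
  "commutator_subgroup G A B =
     generate G (\<Union>a\<in>A. \<Union>b\<in>B. {a \<otimes>\<^bsub>G\<^esub> b \<otimes>\<^bsub>G\<^esub> inv\<^bsub>G\<^esub> a \<otimes>\<^bsub>G\<^esub> inv\<^bsub>G\<^esub> b})"

text \<open>The lower central series starts at index 1; the value at 0 is a dummy.\<close>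

fun lower_central :: "('a, 'm) monoid_scheme \<Rightarrow> nat \<Rightarrow> 'a set" where
  "lower_central G 0 = carrier G"
| "lower_central G (Suc 0) = carrier G"
| "lower_central G (Suc (Suc i)) = commutator_subgroup G (lower_central G (Suc i)) (carrier G)"

definition upper_central_factor :: "('a, 'm) monoid_scheme \<Rightarrow> nat \<Rightarrow> 'a set monoid" where
  "upper_central_factor G i = G\<lparr>carrier := upper_central G i\<rparr> Mod upper_central G (i - 1)"

definition lower_central_factor :: "('a, 'm) monoid_scheme \<Rightarrow> nat \<Rightarrow> 'a set monoid" where
  "lower_central_factor G i = G\<lparr>carrier := lower_central G i\<rparr> Mod lower_central G (i + 1)"

end

theory Submission
  imports Defs "HOL-Algebra.Multiplicative_Group" "Jordan_Normal_Form.Spectral_Radius"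
    "Jordan_Normal_Form.Schur_Decomposition"
begin

text \<open>
  Divide every irreducible character by its degree. If \<open>Y = (D\<inverse> X N)\<^sup>T\<close>, the tables of normalized
  characters of \<open>G\<close> and of its transpose group \<open>H\<close> are transposes of each other, and so they are the
  values of one function \<open>w x k\<close> (\<open>x \<in> G\<close>, \<open>k \<in> H\<close>): the functions \<open>\<lambda>x. w x k\<close> are exactly the
  normalized irreducible characters of \<open>G\<close>, and the functions \<open>\<lambda>k. w x k\<close> are exactly those of \<open>H\<close>.
  The notion \<open>dual_pairing\<close> records just this, and everything else follows from it.

  Two properties of a normalized irreducible character \<open>f\<close>, afforded by a representation \<open>\<rho>\<close>, carry
  the argument. First, \<open>\<bar>f x\<bar> = 1\<close> holds iff \<open>\<rho> x\<close> is a scalar matrix: a matrix of finite order whose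
  trace is as large as possible is scalar. By Schur's lemma this happens iff \<open>f\<close> is \<open>1\<close> on all
  commutators \<open>[x, g]\<close>, and then \<open>f (x y) = f x * f y\<close> for every \<open>y\<close> (lemmas
  \<open>finite_order_extremal_trace_scalar\<close>, \<open>extremal_iff_commutators\<close>, \<open>f_mult\<close>). Second, every normal
  subgroup is an intersection of kernels of irreducible representations (lemma
  \<open>normalized_irreducible_character_separates\<close>).

  For a normal subgroup \<open>N\<close> of \<open>G\<close> let \<open>N\<^sup>\<bottom>\<close> be the set of all \<open>k \<in> H\<close> with \<open>w x k = 1\<close> for all
  \<open>x \<in> N\<close>, and let \<open>M / N\<close> be the center of \<open>G / N\<close>. An element \<open>x\<close> lies in \<open>M\<close> iff \<open>[x, G] \<subseteq> N\<close>, that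
  is, iff \<open>w [x, g] k = 1\<close> for all \<open>k \<in> N\<^sup>\<bottom>\<close> and all \<open>g\<close>; by the first property of \<open>\<lambda>x. w x k\<close> this
  means \<open>\<bar>w x k\<bar> = 1\<close> for all \<open>k \<in> N\<^sup>\<bottom>\<close>. This condition is symmetric in the two groups, so the same
  property of \<open>\<lambda>k. w x k\<close> turns it into \<open>w x = 1\<close> on \<open>[N\<^sup>\<bottom>, H]\<close>. Hence
  \<open>M\<^sup>\<bottom> = [N\<^sup>\<bottom>, H]\<close> by the second property, applied to the normal subgroup \<open>[N\<^sup>\<bottom>, H]\<close> of \<open>H\<close>
  (lemma \<open>dual_pairing_central_step\<close>), and by induction \<open>Z\<^sub>i(G)\<^sup>\<bottom> = \<gamma>\<^sub>i\<^sub>+\<^sub>1(H)\<close>. Moreover \<open>w\<close> is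
  multiplicative in both arguments on \<open>M \<times> N\<^sup>\<bottom>\<close>, with left kernel \<open>N\<close> and right kernel \<open>M\<^sup>\<bottom>\<close>. For
  \<open>N = Z\<^sub>i\<^sub>-\<^sub>1(G)\<close> this gives a perfect pairing of \<open>Z\<^sub>i(G) / Z\<^sub>i\<^sub>-\<^sub>1(G)\<close> with \<open>\<gamma>\<^sub>i(H) / \<gamma>\<^sub>i\<^sub>+\<^sub>1(H)\<close>
  into the nonzero complex numbers, and finite groups that are perfectly paired in this way are
  abelian and isomorphic (lemmas \<open>bimultiplicative_factor_comm_group\<close>, \<open>perfect_pairing_iso\<close>).
\<close>

section \<open>Matrices of finite order\<close>

lemma mat_trace_mult_commute:
  assumes "A \<in> carrier_mat n m" "B \<in> carrier_mat m n"
  shows "mat_trace (A * B) = mat_trace (B * A)"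
proof -
  have "mat_trace (A * B) = (\<Sum>i<n. \<Sum>j<m. A $$ (i,j) * B $$ (j,i))"
    using assms by (simp add: mat_trace_def scalar_prod_def lessThan_atLeast0)
  also have "\<dots> = (\<Sum>j<m. \<Sum>i<n. B $$ (j,i) * A $$ (i,j))"
    by (subst sum.swap) (simp add: mult.commute)
  also have "\<dots> = mat_trace (B * A)"
    using assms by (simp add: mat_trace_def scalar_prod_def lessThan_atLeast0)
  finally show ?thesis .
qed

lemma mat_trace_conjugate:
  assumes "A \<in> carrier_mat n n" "P \<in> carrier_mat n n" "Q \<in> carrier_mat n n" "Q * P = 1\<^sub>m n"
  shows "mat_trace (P * A * Q) = mat_trace A"
proof -
  have "mat_trace (P * A * Q) = mat_trace (Q * (P * A))"
    using assms by (intro mat_trace_mult_commute[of _ n n]) auto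
  also have "Q * (P * A) = A"
    using assms by (simp flip: assoc_mult_mat[of _ n n _ n])
  finally show ?thesis .
qed

lemma mat_trace_smult: "A \<in> carrier_mat n n \<Longrightarrow> mat_trace (c \<cdot>\<^sub>m A) = c * mat_trace A"
  by (simp add: mat_trace_def sum_distrib_left)

lemma mat_trace_one: "mat_trace (1\<^sub>m n) = of_nat n"
  by (simp add: mat_trace_def)

text \<open>The equality case of the triangle inequality: if \<open>s\<close> is the mean of the \<open>l i\<close> and \<open>\<bar>s\<bar> = 1\<close>, the
  real parts of \<open>l i * cnj s\<close> are at most \<open>1\<close> and have mean \<open>1\<close>, so each of them is \<open>1\<close>.\<close>
lemma unit_complex_sum_extremal:
  fixes l :: "nat \<Rightarrow> complex"
  assumes norm1: "\<And>i. i < n \<Longrightarrow> cmod (l i) = 1" and ext: "cmod (\<Sum>i<n. l i) = of_nat n" and i: "i < n"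
  shows "l i = (\<Sum>i<n. l i) / of_nat n"
proof -
  define s where "s = (\<Sum>i<n. l i) / of_nat n"
  have n: "n > 0" using i by simp
  have s1: "cmod s = 1" using ext n by (simp add: s_def norm_divide)
  have ss: "s * cnj s = 1" using s1 by (simp add: complex_norm_square[symmetric])
  have cmod1: "cmod (l j * cnj s) = 1" if "j < n" for j
    using norm1[OF that] s1 by (simp add: norm_mult)
  have "(\<Sum>j<n. 1 - Re (l j * cnj s)) = of_nat n - Re ((\<Sum>j<n. l j) * cnj s)"
    by (simp add: sum_subtractf sum_distrib_right del: times_complex.sel complex_cnj)
  also have "(\<Sum>j<n. l j) = of_nat n * s" using n by (simp add: s_def)
  also have "of_nat n - Re (of_nat n * s * cnj s) = (0::real)"
    using ss by (simp add: mult.assoc)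
  finally have "(\<Sum>j<n. 1 - Re (l j * cnj s)) = 0" .
  moreover have "0 \<le> 1 - Re (l j * cnj s)" if "j \<in> {..<n}" for j
    using complex_Re_le_cmod[of "l j * cnj s"] cmod1 that by simp
  ultimately have "\<forall>j\<in>{..<n}. 1 - Re (l j * cnj s) = 0"
    by (subst (asm) sum_nonneg_eq_0_iff) auto
  hence "Re (l i * cnj s) = 1" using i by simp
  moreover have "(Re (l i * cnj s))\<^sup>2 + (Im (l i * cnj s))\<^sup>2 = 1"
    using cmod1[OF i] by (simp only: cmod_power2[symmetric]) simp
  ultimately have "l i * cnj s = 1" by (simp only: complex_eq_iff) simp
  hence "l i * (cnj s * s) = s" by (simp flip: mult.assoc)
  thus ?thesis using ss by (simp add: s_def mult.commute)
qed

text \<open>Were some entry above the diagonal nonzero, take one, \<open>T $$ (a, a + d)\<close>, on the lowest nonzero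
  superdiagonal. There the powers behave as in the derivative of \<open>c ^ k\<close>: the entry of \<open>T ^ k\<close> at
  this place is \<open>k * c ^ (k - 1) * T $$ (a, a + d)\<close>, which for \<open>k = m\<close> contradicts \<open>T ^ m = 1\<close>.\<close>
lemma upper_triangular_finite_order_scalar:
  fixes T :: "complex mat"
  assumes T: "T \<in> carrier_mat n n" and ut: "upper_triangular T"
    and diag: "\<And>i. i < n \<Longrightarrow> T $$ (i,i) = c" and c: "c \<noteq> 0"
    and m: "m > 0" and Tm: "T ^\<^sub>m m = 1\<^sub>m n"
  shows "T = c \<cdot>\<^sub>m 1\<^sub>m n"
proof -
  have off: "T $$ (a, a + d) = 0" if "d > 0" "a + d < n" for a d
    using that
  proof (induction d arbitrary: a rule: less_induct)
    case (less d a)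
    have zero: "T $$ (b, e) = 0" if "b < n" "e < n" "b \<noteq> e" "e < b + d" for b e
    proof (cases "e < b")
      case True thus ?thesis using ut T that by auto
    next
      case False
      thus ?thesis using less.IH[of "e - b" b] that by simp
    qed
    \<comment> \<open>One factor \<open>c\<close> is moved to the left to avoid the exponent \<open>k - 1\<close>.\<close>
    have pow: "(\<forall>b e. b < n \<longrightarrow> e < n \<longrightarrow> e < b + d \<longrightarrow> (T ^\<^sub>m k) $$ (b, e) = (if b = e then c ^ k else 0))
        \<and> (T ^\<^sub>m k) $$ (a, a + d) * c = of_nat k * c ^ k * T $$ (a, a + d)" for k
    proof (induction k)
      case 0
      show ?case using T less.prems by auto
    next
      case (Suc k)
      have Tk: "T ^\<^sub>m k \<in> carrier_mat n n" using T by simp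
      have entry: "(T ^\<^sub>m Suc k) $$ (b, e) = (\<Sum>i<n. (T ^\<^sub>m k) $$ (b, i) * T $$ (i, e))"
        if "b < n" "e < n" for b e
        using that T Tk by (simp add: scalar_prod_def lessThan_atLeast0)
      have "(T ^\<^sub>m Suc k) $$ (b, e) = (if b = e then c ^ Suc k else 0)"
        if be: "b < n" "e < n" "e < b + d" for b e
      proof -
        have "(\<Sum>i<n. (T ^\<^sub>m k) $$ (b, i) * T $$ (i, e)) = (\<Sum>i<n. if i = b then c ^ k * T $$ (b, e) else 0)"
        proof (rule sum.cong[OF refl])
          fix i assume "i \<in> {..<n}"
          hence i: "i < n" by simp
          show "(T ^\<^sub>m k) $$ (b, i) * T $$ (i, e) = (if i = b then c ^ k * T $$ (b, e) else 0)"
          proof (cases "i < b + d")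
            case True
            thus ?thesis using Suc.IH i be by auto
          next
            case False
            hence "T $$ (i, e) = 0" using zero[of i e] i be by auto
            moreover have "i \<noteq> b" using False less.prems(1) by simp
            ultimately show ?thesis by simp
          qed
        qed
        also have "\<dots> = (if b = e then c ^ Suc k else 0)"
          using be zero diag by auto
        finally show ?thesis using entry be by simp
      qed
      moreover have "(T ^\<^sub>m Suc k) $$ (a, a + d) * c = of_nat (Suc k) * c ^ Suc k * T $$ (a, a + d)"
      proof -
        have "(\<Sum>i<n. (T ^\<^sub>m k) $$ (a, i) * T $$ (i, a + d)) =
          (\<Sum>i<n. (if i = a then c ^ k * T $$ (a, a + d) else 0)
                 + (if i = a + d then (T ^\<^sub>m k) $$ (a, a + d) * c else 0))"
        proof (rule sum.cong[OF refl])
          fix i assume "i \<in> {..<n}"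
          hence i: "i < n" by simp
          have a: "a < n" using less.prems by simp
          consider "i = a" | "i = a + d" | "i \<noteq> a" "i < a + d" | "i > a + d" by linarith
          thus "(T ^\<^sub>m k) $$ (a, i) * T $$ (i, a + d) = (if i = a then c ^ k * T $$ (a, a + d) else 0)
                 + (if i = a + d then (T ^\<^sub>m k) $$ (a, a + d) * c else 0)"
            using Suc.IH i a less.prems diag zero[of i "a + d"] by cases auto
        qed
        also have "\<dots> = c ^ k * T $$ (a, a + d) + (T ^\<^sub>m k) $$ (a, a + d) * c"
          using less.prems by (simp add: sum.distrib)
        also have "\<dots> = c ^ k * T $$ (a, a + d) + of_nat k * c ^ k * T $$ (a, a + d)"
          using Suc.IH by simp
        finally show ?thesis using entry[of a "a + d"] less.prems by (simp add: algebra_simps)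
      qed
      ultimately show ?case by blast
    qed
    from pow[of m] have "of_nat m * c ^ m * T $$ (a, a + d) = 0"
      using Tm less.prems by simp
    thus ?case using m c by simp
  qed
  show ?thesis
  proof (rule eq_matI)
    fix i j assume "i < dim_row (c \<cdot>\<^sub>m 1\<^sub>m n)" "j < dim_col (c \<cdot>\<^sub>m 1\<^sub>m n)"
    hence ij: "i < n" "j < n" by auto
    consider "i = j" | "j < i" | "i < j" by linarith
    thus "T $$ (i, j) = (c \<cdot>\<^sub>m 1\<^sub>m n) $$ (i, j)"
    proof cases
      case 3
      thus ?thesis using off[of "j - i" i] ij by simp
    qed (use ij ut T diag in auto)
  qed (use T in auto)
qed

text \<open>The eigenvalues are \<open>n\<close> roots of unity whose sum has absolute value \<open>n\<close>, so they all coincide. A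
  Schur triangular form of \<open>A\<close> then has constant diagonal, and finite order makes it scalar.\<close>
lemma finite_order_extremal_trace_scalar:
  fixes A :: "complex mat"
  assumes A: "A \<in> carrier_mat n n" and m: "m > 0" and Am: "A ^\<^sub>m m = 1\<^sub>m n"
    and tr: "cmod (mat_trace A) = of_nat n"
  shows "A = (mat_trace A / of_nat n) \<cdot>\<^sub>m 1\<^sub>m n"
proof (cases "n = 0")
  case True
  thus ?thesis using A by auto
next
  case False
  obtain es where es: "char_poly A = (\<Prod>a\<leftarrow>es. [:- a, 1:])" using char_poly_factorized[OF A] by auto
  obtain T where T: "T \<in> carrier_mat n n" and ut: "upper_triangular T" and sim: "similar_mat A T"
    using schur_decomposition_exists[OF A es] by blast
  then obtain P Q where wit: "similar_mat_wit A T P Q" unfolding similar_mat_def by blast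
  note PQ = similar_mat_witD2[OF A wit]
  have trT: "mat_trace T = mat_trace A"
    unfolding PQ(3) using PQ by (intro mat_trace_conjugate[symmetric]) auto
  have "similar_mat_wit T A Q P" using wit by (rule similar_mat_wit_sym)
  hence Tm: "T ^\<^sub>m m = 1\<^sub>m n"
    using similar_mat_wit_pow_id[of T A Q P m] Am PQ by simp
  have dpow: "(T ^\<^sub>m k) $$ (i,i) = (T $$ (i,i)) ^ k" if "i < n" for i k
  proof -
    have "\<forall>i<n. \<forall>j\<le>i. (T ^\<^sub>m k) $$ (i,j) = (if i = j then (T $$ (i,i)) ^ k else 0)"
    proof (induction k)
      case 0
      show ?case using T by auto
    next
      case (Suc k)
      have Tk: "T ^\<^sub>m k \<in> carrier_mat n n" using T by simp
      show ?case
      proof (intro allI impI)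
        fix i j assume ij: "i < n" "j \<le> i"
        have "(T ^\<^sub>m Suc k) $$ (i,j) = (\<Sum>l<n. (T ^\<^sub>m k) $$ (i,l) * T $$ (l,j))"
          using ij T Tk by (simp add: scalar_prod_def lessThan_atLeast0)
        also have "\<dots> = (\<Sum>l<n. if l = i then (T $$ (i,i)) ^ k * T $$ (i,j) else 0)"
        proof (rule sum.cong[OF refl])
          fix l assume "l \<in> {..<n}"
          thus "(T ^\<^sub>m k) $$ (i,l) * T $$ (l,j) = (if l = i then (T $$ (i,i)) ^ k * T $$ (i,j) else 0)"
            using Suc.IH ij upper_triangularD[OF ut, of j l] T by (cases "l \<le> i") auto
        qed
        also have "\<dots> = (if i = j then (T $$ (i,i)) ^ Suc k else 0)"
          using ij upper_triangularD[OF ut, of j i] T by (cases "i = j") auto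
        finally show "(T ^\<^sub>m Suc k) $$ (i,j) = (if i = j then (T $$ (i,i)) ^ Suc k else 0)" .
      qed
    qed
    thus ?thesis using that T by auto
  qed
  have root: "(T $$ (i,i)) ^ m = 1" if "i < n" for i
    using dpow[OF that, of m] Tm that by simp
  have norm1: "cmod (T $$ (i,i)) = 1" if "i < n" for i
  proof -
    have "cmod (T $$ (i,i)) ^ m = 1 ^ m" using root[OF that] by (simp flip: norm_power)
    thus ?thesis using m power_eq_imp_eq_base[of "cmod (T $$ (i,i))" m 1] by simp
  qed
  have trsum: "mat_trace T = (\<Sum>i<n. T $$ (i,i))" using T by (simp add: mat_trace_def)
  have diag: "T $$ (i,i) = mat_trace A / of_nat n" if "i < n" for i
    using unit_complex_sum_extremal[of n "\<lambda>i. T $$ (i,i)" i] norm1 that tr trT trsum by simp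
  have "mat_trace A / of_nat n \<noteq> 0" using tr False by auto
  hence "T = (mat_trace A / of_nat n) \<cdot>\<^sub>m 1\<^sub>m n"
    using upper_triangular_finite_order_scalar[OF T ut diag _ m Tm] by simp
  hence "A = P * ((mat_trace A / of_nat n) \<cdot>\<^sub>m 1\<^sub>m n) * Q" using PQ(3) by simp
  also have "\<dots> = (mat_trace A / of_nat n) \<cdot>\<^sub>m 1\<^sub>m n"
    by (simp only: mult_smult_distrib[OF PQ(6) one_carrier_mat] right_mult_one_mat[OF PQ(6)]
        mult_smult_assoc_mat[OF PQ(6,7)] PQ(1))
  finally show ?thesis .
qed

section \<open>Matrix representations\<close>

lemma GL_complex_simps:
  "carrier (GL_complex n) = {A \<in> carrier_mat n n. \<exists>B\<in>carrier_mat n n. B * A = 1\<^sub>m n \<and> A * B = 1\<^sub>m n}"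
  "monoid.mult (GL_complex n) = (*)" "monoid.one (GL_complex n) = 1\<^sub>m n"
  by (auto simp: GL_complex_def units_of_def Units_def ring_mat_simps)

lemma group_GL_complex: "group (GL_complex n)"
proof -
  interpret R: ring "ring_mat TYPE(complex) n ()" by (rule ring_mat)
  show ?thesis unfolding GL_complex_def by (rule R.units_group)
qed

lemma representation_iff:
  assumes "group G"
  shows "representation G n \<rho> \<longleftrightarrow> (\<forall>g\<in>carrier G. \<rho> g \<in> carrier_mat n n) \<and> \<rho> \<one>\<^bsub>G\<^esub> = 1\<^sub>m n \<and>
    (\<forall>g\<in>carrier G. \<forall>h\<in>carrier G. \<rho> (g \<otimes>\<^bsub>G\<^esub> h) = \<rho> g * \<rho> h)"
proof -
  interpret group G by fact
  show ?thesis
  proof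
    assume r: "representation G n \<rho>"
    then interpret gh: group_hom G "GL_complex n" \<rho>
      by (intro group_hom.intro group_hom_axioms.intro group_GL_complex group_axioms)
        (simp add: representation_def)
    show "(\<forall>g\<in>carrier G. \<rho> g \<in> carrier_mat n n) \<and> \<rho> \<one>\<^bsub>G\<^esub> = 1\<^sub>m n \<and>
        (\<forall>g\<in>carrier G. \<forall>h\<in>carrier G. \<rho> (g \<otimes>\<^bsub>G\<^esub> h) = \<rho> g * \<rho> h)"
      using gh.hom_closed gh.hom_one gh.hom_mult by (auto simp: GL_complex_simps)
  next
    assume r: "(\<forall>g\<in>carrier G. \<rho> g \<in> carrier_mat n n) \<and> \<rho> \<one>\<^bsub>G\<^esub> = 1\<^sub>m n \<and>
        (\<forall>g\<in>carrier G. \<forall>h\<in>carrier G. \<rho> (g \<otimes>\<^bsub>G\<^esub> h) = \<rho> g * \<rho> h)"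
    have "\<rho> g \<in> carrier (GL_complex n)" if g: "g \<in> carrier G" for g
    proof -
      have "\<rho> (inv\<^bsub>G\<^esub> g \<otimes>\<^bsub>G\<^esub> g) = \<rho> (inv\<^bsub>G\<^esub> g) * \<rho> g" "\<rho> (g \<otimes>\<^bsub>G\<^esub> inv\<^bsub>G\<^esub> g) = \<rho> g * \<rho> (inv\<^bsub>G\<^esub> g)"
        using r g inv_closed[OF g] by blast+
      moreover have "\<rho> \<one>\<^bsub>G\<^esub> = 1\<^sub>m n" using r by blast
      ultimately have "\<rho> (inv\<^bsub>G\<^esub> g) * \<rho> g = 1\<^sub>m n" "\<rho> g * \<rho> (inv\<^bsub>G\<^esub> g) = 1\<^sub>m n"
        by (simp_all only: l_inv[OF g] r_inv[OF g])
      moreover have "\<rho> g \<in> carrier_mat n n" "\<rho> (inv\<^bsub>G\<^esub> g) \<in> carrier_mat n n"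
        using r g inv_closed[OF g] by blast+
      ultimately show ?thesis unfolding GL_complex_simps by blast
    qed
    thus "representation G n \<rho>" using r by (auto simp: representation_def hom_def GL_complex_simps)
  qed
qed

locale matrix_representation = group G for G (structure) +
  fixes n :: nat and \<rho> :: "'a \<Rightarrow> complex mat"
  assumes rep: "representation G n \<rho>"
begin

lemma rep_closed [simp]: "g \<in> carrier G \<Longrightarrow> \<rho> g \<in> carrier_mat n n"
  and rep_one [simp]: "\<rho> \<one> = 1\<^sub>m n"
  and rep_mult: "g \<in> carrier G \<Longrightarrow> h \<in> carrier G \<Longrightarrow> \<rho> (g \<otimes> h) = \<rho> g * \<rho> h"
  using iffD1[OF representation_iff[OF group_axioms] rep] by blast+

lemma rep_pow: "g \<in> carrier G \<Longrightarrow> \<rho> (g [^] (m::nat)) = \<rho> g ^\<^sub>m m"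
  using carrier_matD(1)[OF rep_closed[of g]] by (induction m) (simp_all add: rep_mult)

lemma rep_pow_order:
  assumes "finite (carrier G)" "g \<in> carrier G"
  shows "\<rho> g ^\<^sub>m Coset.order G = 1\<^sub>m n" "Coset.order G > 0"
  using assms pow_order_eq_1[of g] rep_pow[of g "Coset.order G"] order_gt_0_iff_finite by auto

lemma extremal_trace_scalar:
  assumes "finite (carrier G)" "g \<in> carrier G" "cmod (mat_trace (\<rho> g)) = of_nat n"
  shows "\<rho> g = (mat_trace (\<rho> g) / of_nat n) \<cdot>\<^sub>m 1\<^sub>m n"
  using finite_order_extremal_trace_scalar[OF rep_closed] rep_pow_order assms by blast

lemma trace_eq_degree_imp_one:
  assumes "finite (carrier G)" "g \<in> carrier G" "mat_trace (\<rho> g) = of_nat n"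
  shows "\<rho> g = 1\<^sub>m n"
proof (cases "n = 0")
  case True
  thus ?thesis using rep_closed[OF assms(2)] by auto
next
  case False
  hence "\<rho> g = 1 \<cdot>\<^sub>m 1\<^sub>m n" using extremal_trace_scalar[OF assms(1,2)] assms(3) by simp
  also have "\<dots> = 1\<^sub>m n" by (intro eq_matI) auto
  finally show ?thesis .
qed

end

lemma complex_subspace_iff:
  "VectorSpace.subspace class_ring W (module_vec TYPE(complex) n) \<longleftrightarrow>
     W \<subseteq> carrier_vec n \<and> 0\<^sub>v n \<in> W \<and> (\<forall>v\<in>W. \<forall>w\<in>W. v + w \<in> W) \<and> (\<forall>c. \<forall>v\<in>W. c \<cdot>\<^sub>v v \<in> W)"
  using vec_vs[where ?'a = complex and n = n] vec_module[where ?'a = complex and n = n]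
  unfolding VectorSpace.subspace_def submodule_def module_vec_simps by auto

text \<open>Every eigenspace of \<open>A\<close> is invariant under the representation.\<close>
lemma Schur_scalar:
  assumes G: "group G" and irr: "irreducible_representation G n \<rho>"
    and A: "A \<in> carrier_mat n n" and comm: "\<And>g. g \<in> carrier G \<Longrightarrow> A * \<rho> g = \<rho> g * A"
  shows "\<exists>c. A = c \<cdot>\<^sub>m 1\<^sub>m n"
proof -
  interpret matrix_representation G n \<rho>
    using G irr by (simp add: matrix_representation_def matrix_representation_axioms_def irreducible_representation_def)
  have n: "n > 0" using irr by (simp add: irreducible_representation_def)
  obtain c where "eigenvalue A c"
    using spectrum_non_empty[OF A n] by (auto simp: spectrum_def)
  then obtain v where v: "v \<in> carrier_vec n" "v \<noteq> 0\<^sub>v n" "A *\<^sub>v v = c \<cdot>\<^sub>v v"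
    using A by (auto simp: eigenvalue_def eigenvector_def)
  define W where "W = {w \<in> carrier_vec n. A *\<^sub>v w = c \<cdot>\<^sub>v w}"
  have "invariant_subspace G n \<rho> W"
    unfolding invariant_subspace_def
  proof (intro conjI ballI)
    show "VectorSpace.subspace class_ring W (module_vec TYPE(complex) n)"
      using A unfolding complex_subspace_iff W_def
      by (auto simp: mult_add_distrib_mat_vec[OF A] smult_add_distrib_vec mult_mat_vec[OF A] smult_smult_assoc mult.commute)
    fix g w assume g: "g \<in> carrier G" and w: "w \<in> W"
    have wc: "w \<in> carrier_vec n" using w by (simp add: W_def)
    have "A *\<^sub>v (\<rho> g *\<^sub>v w) = \<rho> g *\<^sub>v (A *\<^sub>v w)"
      using assoc_mult_mat_vec[OF A rep_closed[OF g] wc] assoc_mult_mat_vec[OF rep_closed[OF g] A wc]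
        comm[OF g] by simp
    also have "\<dots> = c \<cdot>\<^sub>v (\<rho> g *\<^sub>v w)"
      using w g by (simp add: W_def mult_mat_vec[OF rep_closed[OF g]])
    finally show "\<rho> g *\<^sub>v w \<in> W" using g w by (auto simp: W_def intro!: mult_mat_vec_carrier)
  qed
  moreover have "W \<noteq> {0\<^sub>v n}" using v by (auto simp: W_def)
  ultimately have "W = carrier_vec n" using irr by (auto simp: irreducible_representation_def)
  hence ev: "A *\<^sub>v w = c \<cdot>\<^sub>v w" if "w \<in> carrier_vec n" for w using that by (auto simp: W_def)
  have "A = c \<cdot>\<^sub>m 1\<^sub>m n"
  proof (rule eq_matI)
    fix i j assume "i < dim_row (c \<cdot>\<^sub>m 1\<^sub>m n)" "j < dim_col (c \<cdot>\<^sub>m 1\<^sub>m n)"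
    hence ij: "i < n" "j < n" by auto
    have "A $$ (i, j) = (A *\<^sub>v unit_vec n j) $ i"
      using ij A by (simp add: scalar_prod_right_unit)
    also have "\<dots> = c * unit_vec n j $ i" using ev[of "unit_vec n j"] ij by simp
    finally show "A $$ (i, j) = (c \<cdot>\<^sub>m 1\<^sub>m n) $$ (i, j)" using ij by simp
  qed (use A in auto)
  thus ?thesis ..
qed

section \<open>Irreducible representations separate points\<close>

text \<open>The exchange step of Steinitz as a matrix identity: the unit matrix with one column replaced by a
  vector \<open>c\<close> is invertible as soon as \<open>c $ i \<noteq> 0\<close>.\<close>
lemma column_replacement_inverse:
  fixes c :: "complex vec"
  assumes c: "c \<in> carrier_vec n" and i: "i < n" "c $ i \<noteq> 0"
  defines "E \<equiv> mat n n (\<lambda>(a,b). if b = i then c $ a else if a = b then 1 else 0)"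
    and "F \<equiv> mat n n (\<lambda>(a,b). if b = i then (if a = i then 1 / c $ i else - c $ a / c $ i) else if a = b then 1 else 0)"
  shows "E * F = 1\<^sub>m n"
proof (rule eq_matI)
  fix a b assume "a < dim_row (1\<^sub>m n)" "b < dim_col (1\<^sub>m n)"
  hence ab: "a < n" "b < n" by auto
  have "(E * F) $$ (a,b) = (\<Sum>d<n. E $$ (a,d) * F $$ (d,b))"
    using ab by (simp add: E_def F_def scalar_prod_def lessThan_atLeast0)
  also have "\<dots> = (if b = i then E $$ (a,i) * F $$ (i,i) + (if a = i then 0 else F $$ (a,i)) else E $$ (a,b))"
  proof (cases "b = i")
    case True
    have "(\<Sum>d<n. E $$ (a,d) * F $$ (d,b)) =
      (\<Sum>d<n. (if d = i then E $$ (a,i) * F $$ (i,i) else 0) + (if d = a then (if a = i then 0 else F $$ (a,i)) else 0))"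
      using ab True by (intro sum.cong) (auto simp: E_def)
    thus ?thesis using True ab i by (simp add: sum.distrib)
  next
    case False
    have "(\<Sum>d<n. E $$ (a,d) * F $$ (d,b)) = (\<Sum>d<n. if d = b then E $$ (a,b) else 0)"
      using ab False by (intro sum.cong) (auto simp: F_def)
    thus ?thesis using False ab by simp
  qed
  also have "\<dots> = 1\<^sub>m n $$ (a,b)" using ab i by (auto simp: E_def F_def)
  finally show "(E * F) $$ (a,b) = 1\<^sub>m n $$ (a,b)" .
qed (auto simp: E_def F_def)

lemma mat_mult_unit_vec:
  fixes P :: "complex mat"
  assumes "P \<in> carrier_mat n n" "j < n"
  shows "P *\<^sub>v unit_vec n j = col P j"
  using assms by (intro eq_vecI) (auto simp: scalar_prod_right_unit)

lemma mat_vec_in_subspace: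
  fixes P :: "complex mat"
  assumes W: "VectorSpace.subspace class_ring W (module_vec TYPE(complex) n)"
    and P: "P \<in> carrier_mat n n" and cols: "\<And>j. j < n \<Longrightarrow> col P j \<in> W" and u: "u \<in> carrier_vec n"
  shows "P *\<^sub>v u \<in> W"
proof -
  have "m \<le> n \<Longrightarrow> P *\<^sub>v vec n (\<lambda>i. if i < m then u $ i else 0) \<in> W" for m
  proof (induction m)
    case 0
    have "P *\<^sub>v vec n (\<lambda>i. 0) = 0\<^sub>v n" using P by (intro eq_vecI) (auto simp: scalar_prod_def)
    thus ?case using W by (simp add: complex_subspace_iff)
  next
    case (Suc m)
    let ?v = "vec n (\<lambda>i. if i < m then u $ i else 0)"
    have "vec n (\<lambda>i. if i < Suc m then u $ i else 0) = ?v + u $ m \<cdot>\<^sub>v unit_vec n m"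
      using Suc.prems by (intro eq_vecI) (auto simp: less_Suc_eq)
    hence "P *\<^sub>v vec n (\<lambda>i. if i < Suc m then u $ i else 0) = P *\<^sub>v ?v + u $ m \<cdot>\<^sub>v (P *\<^sub>v unit_vec n m)"
      by (simp add: mult_add_distrib_mat_vec[OF P] mult_mat_vec[OF P])
    also have "P *\<^sub>v unit_vec n m = col P m"
      using mat_mult_unit_vec[OF P] Suc.prems by simp
    finally show ?case using Suc cols[of m] W by (simp add: complex_subspace_iff)
  qed
  from this[of n] have "P *\<^sub>v vec n (\<lambda>i. if i < n then u $ i else 0) \<in> W" by simp
  also have "vec n (\<lambda>i. if i < n then u $ i else 0) = u" using u by (intro eq_vecI) auto
  finally show ?thesis .
qed

text \<open>The columns of \<open>P\<close> form a basis of the whole space, and those with index in \<open>J\<close> span \<open>W\<close>. Such a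
  basis is found by maximizing the number of basis vectors that lie in \<open>W\<close>: a vector of \<open>W\<close> with a
  nonzero coordinate outside \<open>J\<close> could be exchanged for the corresponding basis vector.\<close>
lemma subspace_adapted_basis:
  assumes W: "VectorSpace.subspace class_ring W (module_vec TYPE(complex) n)"
    and nontriv: "W \<noteq> {0\<^sub>v n}" "W \<noteq> carrier_vec n"
  obtains P Q J where "P \<in> carrier_mat n n" "Q \<in> carrier_mat n n" "P * Q = 1\<^sub>m n" "Q * P = 1\<^sub>m n"
    "J \<subseteq> {..<n}" "J \<noteq> {}" "J \<noteq> {..<n}" "\<And>j. j \<in> J \<Longrightarrow> col P j \<in> W"
    "\<And>w i. w \<in> W \<Longrightarrow> i < n \<Longrightarrow> i \<notin> J \<Longrightarrow> (Q *\<^sub>v w) $ i = 0"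
proof -
  define good where "good k \<longleftrightarrow> (\<exists>P Q J. P \<in> carrier_mat n n \<and> Q \<in> carrier_mat n n \<and> P * Q = 1\<^sub>m n \<and> Q * P = 1\<^sub>m n \<and>
    J \<subseteq> {..<n} \<and> (\<forall>j\<in>J. col P j \<in> W) \<and> card J = k)" for k
  have Wc: "W \<subseteq> carrier_vec n" using W by (simp add: complex_subspace_iff)
  have good0: "good 0"
    unfolding good_def by (intro exI[of _ "1\<^sub>m n"] exI[of _ "{}"]) auto
  have bound: "k \<le> n" if "good k" for k
    using that unfolding good_def by (auto dest: card_mono[OF finite_lessThan])
  define k where "k = (GREATEST k. good k)"
  have k: "good k" unfolding k_def using good0 bound by (rule GreatestI_nat)
  have kmax: "l \<le> k" if "good l" for l unfolding k_def using that bound by (rule Greatest_le_nat)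
  from k obtain P Q J where PQ: "P \<in> carrier_mat n n" "Q \<in> carrier_mat n n" "P * Q = 1\<^sub>m n" "Q * P = 1\<^sub>m n"
    and J: "J \<subseteq> {..<n}" "card J = k" and colJ: "\<And>j. j \<in> J \<Longrightarrow> col P j \<in> W"
    unfolding good_def by auto
  have PQv: "P *\<^sub>v (Q *\<^sub>v w) = w" if "w \<in> carrier_vec n" for w
    using PQ that by (simp flip: assoc_mult_mat_vec[of _ n n _ n])
  have zero: "(Q *\<^sub>v w) $ i = 0" if w: "w \<in> W" and i: "i < n" "i \<notin> J" for w i
  proof (rule ccontr)
    assume nz: "(Q *\<^sub>v w) $ i \<noteq> 0"
    define c where "c = Q *\<^sub>v w"
    have wc: "w \<in> carrier_vec n" using w Wc by auto
    have c: "c \<in> carrier_vec n" using PQ(2) wc by (simp add: c_def)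
    define E where "E = mat n n (\<lambda>(a,b). if b = i then c $ a else if a = b then 1 else 0)"
    define F where "F = mat n n (\<lambda>(a,b). if b = i then (if a = i then 1 / c $ i else - c $ a / c $ i)
      else if a = b then 1 else 0)"
    have EF: "E \<in> carrier_mat n n" "F \<in> carrier_mat n n" by (simp_all add: E_def F_def)
    have 1: "E * F = 1\<^sub>m n"
      using column_replacement_inverse[OF c i(1)] nz unfolding E_def F_def c_def by simp
    have 2: "F * E = 1\<^sub>m n" using mat_mult_left_right_inverse[OF EF 1] .
    have colE: "col E j = (if j = i then c else unit_vec n j)" if "j < n" for j
      using that c by (intro eq_vecI) (auto simp: E_def)
    have colPE: "col (P * E) j = (if j = i then w else col P j)" if "j < n" for j
      using col_mult2[OF PQ(1) EF(1) that] colE[OF that] PQv[OF wc] mat_mult_unit_vec[OF PQ(1) that]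
      by (simp add: c_def)
    have "good (card (insert i J))"
      unfolding good_def
    proof (intro exI conjI)
      show "P * E \<in> carrier_mat n n" "F * Q \<in> carrier_mat n n" using PQ EF by auto
      have "P * E * (F * Q) = P * (E * (F * Q))"
        using PQ EF by (simp add: assoc_mult_mat[of _ n n _ n _ n])
      also have "E * (F * Q) = (E * F) * Q" using assoc_mult_mat[OF EF PQ(2)] by simp
      also have "P * (E * F * Q) = 1\<^sub>m n" unfolding 1 using PQ by simp
      finally show "P * E * (F * Q) = 1\<^sub>m n" .
      have "F * Q * (P * E) = F * (Q * (P * E))"
        using PQ EF by (simp add: assoc_mult_mat[of _ n n _ n _ n])
      also have "Q * (P * E) = (Q * P) * E" using assoc_mult_mat[OF PQ(2,1) EF(1)] by simp
      also have "F * (Q * P * E) = 1\<^sub>m n" unfolding PQ(4) using EF 2 by simp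
      finally show "F * Q * (P * E) = 1\<^sub>m n" .
      show "insert i J \<subseteq> {..<n}" using J i by auto
      show "\<forall>j\<in>insert i J. col (P * E) j \<in> W"
        using colPE J(1) colJ w i(1) by auto
    qed simp
    moreover have "finite J" using J(1) finite_subset by blast
    ultimately show False using kmax[of "card (insert i J)"] i(2) J(2) by simp
  qed
  have "J \<noteq> {}"
  proof
    assume "J = {}"
    have "w = 0\<^sub>v n" if w: "w \<in> W" for w
    proof -
      have "Q *\<^sub>v w = 0\<^sub>v n" using zero[OF w] \<open>J = {}\<close> PQ(2) by (intro eq_vecI) auto
      hence "w = P *\<^sub>v 0\<^sub>v n" using PQv[of w] w Wc by auto
      also have "\<dots> = 0\<^sub>v n" using PQ(1) by (intro eq_vecI) auto
      finally show ?thesis .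
    qed
    thus False using nontriv(1) W by (auto simp: complex_subspace_iff)
  qed
  moreover have "J \<noteq> {..<n}"
  proof
    assume "J = {..<n}"
    hence "P *\<^sub>v (Q *\<^sub>v v) \<in> W" if "v \<in> carrier_vec n" for v
      using colJ PQ(2) that by (intro mat_vec_in_subspace[OF W PQ(1)]) auto
    thus False using PQv Wc nontriv(2) by auto
  qed
  ultimately show ?thesis using that PQ J(1) colJ zero by blast
qed

text \<open>The map \<open>e\<close> enumerates the index set; this lets a block sit at any set of indices, so that adapted
  bases need not be sorted.\<close>
definition principal_submatrix :: "(nat \<Rightarrow> nat) \<Rightarrow> nat \<Rightarrow> complex mat \<Rightarrow> complex mat" where
  "principal_submatrix e m M = mat m m (\<lambda>(a,b). M $$ (e a, e b))"

lemma principal_submatrix_mult: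
  assumes e: "bij_betw e {..<m} S" and S: "S \<subseteq> {..<n}"
    and M: "M \<in> carrier_mat n n" and N: "N \<in> carrier_mat n n"
    and off: "\<And>a b c. a \<in> S \<Longrightarrow> b \<in> S \<Longrightarrow> c < n \<Longrightarrow> c \<notin> S \<Longrightarrow> M $$ (a,c) * N $$ (c,b) = 0"
  shows "principal_submatrix e m (M * N) = principal_submatrix e m M * principal_submatrix e m N"
proof (rule eq_matI)
  fix a b
  assume "a < dim_row (principal_submatrix e m M * principal_submatrix e m N)"
    "b < dim_col (principal_submatrix e m M * principal_submatrix e m N)"
  hence ab: "a < m" "b < m" by (auto simp: principal_submatrix_def)
  hence eab: "e a \<in> S" "e b \<in> S" using e by (auto simp: bij_betw_def)
  have "principal_submatrix e m (M * N) $$ (a,b) = (\<Sum>c<n. M $$ (e a, c) * N $$ (c, e b))"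
    using ab eab S M N by (simp add: principal_submatrix_def scalar_prod_def lessThan_atLeast0 subset_iff)
  also have "\<dots> = (\<Sum>c\<in>S. M $$ (e a, c) * N $$ (c, e b))"
    using S off[OF eab] by (intro sum.mono_neutral_right) auto
  also have "\<dots> = (\<Sum>c<m. M $$ (e a, e c) * N $$ (e c, e b))"
    by (rule sum.reindex_bij_betw[OF e, symmetric])
  also have "\<dots> = (principal_submatrix e m M * principal_submatrix e m N) $$ (a,b)"
    using ab by (simp add: principal_submatrix_def scalar_prod_def lessThan_atLeast0)
  finally show "principal_submatrix e m (M * N) $$ (a,b) =
    (principal_submatrix e m M * principal_submatrix e m N) $$ (a,b)" .
qed (auto simp: principal_submatrix_def)

lemma mat_trace_principal_submatrix:
  assumes "bij_betw e {..<m} S"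
  shows "mat_trace (principal_submatrix e m M) = (\<Sum>a\<in>S. M $$ (a,a))"
  using sum.reindex_bij_betw[OF assms, of "\<lambda>a. M $$ (a,a)"]
  by (simp add: mat_trace_def principal_submatrix_def)

text \<open>The condition \<open>off\<close> holds both for the index set of an invariant subspace and for its complement;
  the two instances are the subrepresentation and the quotient representation.\<close>
lemma (in matrix_representation) representation_principal_submatrix:
  assumes PQ: "P \<in> carrier_mat n n" "Q \<in> carrier_mat n n" "P * Q = 1\<^sub>m n" "Q * P = 1\<^sub>m n"
    and e: "bij_betw e {..<m} S" and S: "S \<subseteq> {..<n}"
    and off: "\<And>g h a b c. g \<in> carrier G \<Longrightarrow> h \<in> carrier G \<Longrightarrow> a \<in> S \<Longrightarrow> b \<in> S \<Longrightarrow> c < n \<Longrightarrow> c \<notin> S \<Longrightarrow>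
      (Q * \<rho> g * P) $$ (a,c) * (Q * \<rho> h * P) $$ (c,b) = 0"
  shows "representation G m (\<lambda>g. principal_submatrix e m (Q * \<rho> g * P))"
  unfolding representation_iff[OF group_axioms]
proof (intro conjI ballI)
  show "principal_submatrix e m (Q * \<rho> g * P) \<in> carrier_mat m m" for g
    by (simp add: principal_submatrix_def)
  have inj: "inj_on e {..<m}" and eS: "\<And>a. a < m \<Longrightarrow> e a < n"
    using e S by (auto simp: bij_betw_def)
  have "Q * \<rho> \<one> * P = 1\<^sub>m n" using PQ by simp
  moreover have "principal_submatrix e m (1\<^sub>m n) = 1\<^sub>m m"
    using inj eS by (intro eq_matI) (auto simp: principal_submatrix_def inj_on_def)
  ultimately show "principal_submatrix e m (Q * \<rho> \<one> * P) = 1\<^sub>m m" by simp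
  fix g h assume gh: "g \<in> carrier G" "h \<in> carrier G"
  note car = rep_closed[OF gh(1)] rep_closed[OF gh(2)] PQ(1,2)
  have "Q * \<rho> g * P * (Q * \<rho> h * P) = Q * \<rho> g * ((P * Q) * (\<rho> h * P))"
    using car by (simp add: assoc_mult_mat[of _ n n _ n _ n])
  also have "\<dots> = Q * \<rho> (g \<otimes> h) * P"
    unfolding PQ(3) rep_mult[OF gh] using car by (simp add: assoc_mult_mat[of _ n n _ n _ n])
  finally have "Q * \<rho> (g \<otimes> h) * P = Q * \<rho> g * P * (Q * \<rho> h * P)" by simp
  thus "principal_submatrix e m (Q * \<rho> (g \<otimes> h) * P) =
      principal_submatrix e m (Q * \<rho> g * P) * principal_submatrix e m (Q * \<rho> h * P)"
    using principal_submatrix_mult[OF e S _ _ off[OF gh]] car by simp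
qed

text \<open>An invariant subspace gives a subrepresentation and a quotient representation of smaller degree. By
  minimality \<open>x\<close> acts trivially on both, so the trace of \<open>\<rho> x\<close> is the degree \<open>n\<close>, and an element of
  finite order with this trace acts trivially.\<close>
lemma minimal_separating_representation_irreducible:
  assumes G: "group G" and fin: "finite (carrier G)" and x: "x \<in> carrier G"
    and rep: "representation G n \<rho>" and sep: "\<rho> x \<noteq> 1\<^sub>m n"
    and min: "\<And>m \<sigma>. m < n \<Longrightarrow> representation G m \<sigma> \<Longrightarrow> \<sigma> x = 1\<^sub>m m"
  shows "irreducible_representation G n \<rho>"
proof -
  interpret matrix_representation G n \<rho>
    using G rep by (simp add: matrix_representation_def matrix_representation_axioms_def)
  have n: "n > 0" using sep rep_closed[OF x] by (cases n) auto
  have False if inv: "invariant_subspace G n \<rho> W" and nontriv: "W \<noteq> {0\<^sub>v n}" "W \<noteq> carrier_vec n" for W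
  proof -
    have W: "VectorSpace.subspace class_ring W (module_vec TYPE(complex) n)"
      and Winv: "\<And>g w. g \<in> carrier G \<Longrightarrow> w \<in> W \<Longrightarrow> \<rho> g *\<^sub>v w \<in> W"
      using inv by (auto simp: invariant_subspace_def)
    obtain P Q J where PQ: "P \<in> carrier_mat n n" "Q \<in> carrier_mat n n" "P * Q = 1\<^sub>m n" "Q * P = 1\<^sub>m n"
      and J: "J \<subseteq> {..<n}" "J \<noteq> {}" "J \<noteq> {..<n}" and colJ: "\<And>j. j \<in> J \<Longrightarrow> col P j \<in> W"
      and zero: "\<And>w i. w \<in> W \<Longrightarrow> i < n \<Longrightarrow> i \<notin> J \<Longrightarrow> (Q *\<^sub>v w) $ i = 0"
      using subspace_adapted_basis[OF W nontriv] by blast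
    have block: "(Q * \<rho> g * P) $$ (i,j) = 0" if g: "g \<in> carrier G" and ij: "i < n" "i \<notin> J" "j \<in> J" for g i j
    proof -
      have j: "j < n" using J ij by auto
      have "(Q * \<rho> g * P) $$ (i,j) = (col (Q * (\<rho> g * P)) j) $ i"
        using PQ rep_closed[OF g] ij j by (simp add: assoc_mult_mat[of _ n n _ n _ n])
      also have "col (Q * (\<rho> g * P)) j = Q *\<^sub>v (\<rho> g *\<^sub>v col P j)"
        by (simp only: col_mult2[OF PQ(2) mult_carrier_mat[OF rep_closed[OF g] PQ(1)] j]
            col_mult2[OF rep_closed[OF g] PQ(1) j])
      also have "(Q *\<^sub>v (\<rho> g *\<^sub>v col P j)) $ i = 0"
        using zero[OF Winv[OF g colJ]] ij by simp
      finally show ?thesis .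
    qed
    have sub: "(\<Sum>a\<in>S. (Q * \<rho> x * P) $$ (a,a)) = of_nat (card S)"
      if S: "S \<subset> {..<n}" and off: "\<And>g h a b c. g \<in> carrier G \<Longrightarrow> h \<in> carrier G \<Longrightarrow> a \<in> S \<Longrightarrow> b \<in> S \<Longrightarrow> c < n \<Longrightarrow> c \<notin> S \<Longrightarrow>
      (Q * \<rho> g * P) $$ (a,c) * (Q * \<rho> h * P) $$ (c,b) = 0" for S
    proof -
      have "finite S" using S finite_subset by blast
      then obtain e where e: "bij_betw e {..<card S} S"
        using ex_bij_betw_nat_finite[of S] by (auto simp: lessThan_atLeast0)
      have "card S < n" using psubset_card_mono[of "{..<n}" S] S by simp
      moreover have "representation G (card S) (\<lambda>g. principal_submatrix e (card S) (Q * \<rho> g * P))"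
        using representation_principal_submatrix[OF PQ e] S off by blast
      ultimately have "principal_submatrix e (card S) (Q * \<rho> x * P) = 1\<^sub>m (card S)" by (rule min)
      thus ?thesis using mat_trace_principal_submatrix[OF e, of "Q * \<rho> x * P"] by (simp add: mat_trace_one)
    qed
    have "mat_trace (\<rho> x) = mat_trace (Q * \<rho> x * P)"
      using mat_trace_conjugate[OF rep_closed[OF x] PQ(2,1,3)] by simp
    also have "\<dots> = (\<Sum>a<n. (Q * \<rho> x * P) $$ (a,a))" using PQ by (simp add: mat_trace_def)
    also have "\<dots> = (\<Sum>a\<in>{..<n} - J. (Q * \<rho> x * P) $$ (a,a)) + (\<Sum>a\<in>J. (Q * \<rho> x * P) $$ (a,a))"
      using J(1) by (intro sum.subset_diff) auto
    also have "(\<Sum>a\<in>J. (Q * \<rho> x * P) $$ (a,a)) = of_nat (card J)"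
      using J by (intro sub) (auto simp: block)
    also have "(\<Sum>a\<in>{..<n} - J. (Q * \<rho> x * P) $$ (a,a)) = of_nat (card ({..<n} - J))"
      using J by (intro sub) (auto simp: block)
    also have "of_nat (card ({..<n} - J)) + of_nat (card J) = (of_nat n :: complex)"
      using card_Diff_subset[of J "{..<n}"] card_mono[of "{..<n}" J] J(1) finite_subset[OF J(1)]
      by (simp flip: of_nat_add)
    finally show False using trace_eq_degree_imp_one[OF fin x] sep by simp
  qed
  thus ?thesis using rep n unfolding irreducible_representation_def by blast
qed

text \<open>The permutation matrices of left multiplication on \<open>G\<close>, where \<open>e\<close> enumerates the elements.\<close>
lemma regular_representation:
  assumes G: "group G" and fin: "finite (carrier G)"
  shows "\<exists>n \<rho>. representation G n \<rho> \<and> (\<forall>x\<in>carrier G. x \<noteq> \<one>\<^bsub>G\<^esub> \<longrightarrow> \<rho> x \<noteq> 1\<^sub>m n)"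
proof -
  interpret group G by fact
  define n where "n = card (carrier G)"
  obtain e where e: "bij_betw e {..<n} (carrier G)"
    using ex_bij_betw_nat_finite[OF fin] by (auto simp: n_def lessThan_atLeast0)
  have ec: "e a \<in> carrier G" if "a < n" for a using e that by (auto simp: bij_betw_def)
  have einj: "e a = e b \<longleftrightarrow> a = b" if "a < n" "b < n" for a b
    using e that by (auto simp: bij_betw_def inj_on_def)
  define \<rho> where "\<rho> g = mat n n (\<lambda>(a,b). if e a = g \<otimes>\<^bsub>G\<^esub> e b then 1 else (0::complex))" for g
  have "representation G n \<rho>"
    unfolding representation_iff[OF G]
  proof (intro conjI ballI)
    show "\<rho> g \<in> carrier_mat n n" for g by (simp add: \<rho>_def)
    show "\<rho> \<one>\<^bsub>G\<^esub> = 1\<^sub>m n" using ec einj by (intro eq_matI) (auto simp: \<rho>_def)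
    fix g h assume gh: "g \<in> carrier G" "h \<in> carrier G"
    show "\<rho> (g \<otimes>\<^bsub>G\<^esub> h) = \<rho> g * \<rho> h"
    proof (rule eq_matI)
      fix a b assume "a < dim_row (\<rho> g * \<rho> h)" "b < dim_col (\<rho> g * \<rho> h)"
      hence ab: "a < n" "b < n" by (auto simp: \<rho>_def)
      have "h \<otimes>\<^bsub>G\<^esub> e b \<in> e ` {..<n}"
        using e gh(2) ec[OF ab(2)] by (simp add: bij_betw_def)
      then obtain d where d: "d < n" "e d = h \<otimes>\<^bsub>G\<^esub> e b" by auto
      have "(\<rho> g * \<rho> h) $$ (a,b) = (\<Sum>c<n. \<rho> g $$ (a,c) * \<rho> h $$ (c,b))"
        using ab by (simp add: \<rho>_def scalar_prod_def lessThan_atLeast0)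
      also have "\<dots> = (\<Sum>c<n. if c = d then \<rho> g $$ (a,d) else 0)"
      proof (rule sum.cong[OF refl])
        fix c assume "c \<in> {..<n}"
        hence c: "c < n" by simp
        have "e c = h \<otimes>\<^bsub>G\<^esub> e b \<longleftrightarrow> c = d" using einj[OF c d(1)] unfolding d(2) .
        thus "\<rho> g $$ (a,c) * \<rho> h $$ (c,b) = (if c = d then \<rho> g $$ (a,d) else 0)"
          using c ab by (simp add: \<rho>_def)
      qed
      also have "\<dots> = \<rho> g $$ (a,d)" using d by simp
      also have "\<dots> = \<rho> (g \<otimes>\<^bsub>G\<^esub> h) $$ (a,b)"
        using ab d gh ec by (simp add: \<rho>_def m_assoc)
      finally show "\<rho> (g \<otimes>\<^bsub>G\<^esub> h) $$ (a,b) = (\<rho> g * \<rho> h) $$ (a,b)" by simp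
    qed (auto simp: \<rho>_def)
  qed
  moreover have "\<rho> x \<noteq> 1\<^sub>m n" if x: "x \<in> carrier G" "x \<noteq> \<one>\<^bsub>G\<^esub>" for x
  proof
    assume eq: "\<rho> x = 1\<^sub>m n"
    have "\<one>\<^bsub>G\<^esub> \<in> e ` {..<n}" using e by (simp add: bij_betw_def)
    then obtain a where a: "a < n" "e a = \<one>\<^bsub>G\<^esub>" by auto
    have "\<rho> x $$ (a,a) = 1" using eq a by simp
    thus False using a x by (auto simp: \<rho>_def split: if_splits)
  qed
  ultimately show ?thesis by blast
qed

lemma irreducible_representation_separates:
  assumes G: "group G" and fin: "finite (carrier G)" and x: "x \<in> carrier G" "x \<noteq> \<one>\<^bsub>G\<^esub>"
  obtains n \<rho> where "irreducible_representation G n \<rho>" "\<rho> x \<noteq> 1\<^sub>m n"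
proof -
  define good where "good n \<longleftrightarrow> (\<exists>\<rho>. representation G n \<rho> \<and> \<rho> x \<noteq> 1\<^sub>m n)" for n
  define n where "n = (LEAST n. good n)"
  obtain n0 where "good n0" using regular_representation[OF G fin] x unfolding good_def by blast
  hence "good n" unfolding n_def by (rule LeastI)
  then obtain \<rho> where \<rho>: "representation G n \<rho>" "\<rho> x \<noteq> 1\<^sub>m n"
    unfolding good_def by blast
  have "\<sigma> x = 1\<^sub>m m" if "m < n" "representation G m \<sigma>" for m \<sigma>
    using not_less_Least[of m good] that unfolding n_def good_def by blast
  hence "irreducible_representation G n \<rho>"
    by (rule minimal_separating_representation_irreducible[OF G fin x(1) \<rho>])
  thus ?thesis using that \<rho>(2) by blast
qed

section \<open>Normalized irreducible characters\<close>

definition normalized_irreducible_character :: "('a, 'm) monoid_scheme \<Rightarrow> ('a \<Rightarrow> complex) \<Rightarrow> bool" where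
  "normalized_irreducible_character G f \<longleftrightarrow>
     (\<exists>\<chi>\<in>irreducible_characters G. \<chi> \<one>\<^bsub>G\<^esub> \<noteq> 0 \<and> (\<forall>x\<in>carrier G. f x = \<chi> x / \<chi> \<one>\<^bsub>G\<^esub>))"

abbreviation (in group) commutator :: "'a \<Rightarrow> 'a \<Rightarrow> 'a" where
  "commutator x y \<equiv> x \<otimes> y \<otimes> inv x \<otimes> inv y"

lemma irreducible_character_degree:
  assumes G: "group G" and chi: "\<chi> \<in> irreducible_characters G"
  shows "\<chi> \<one>\<^bsub>G\<^esub> \<noteq> 0"
proof -
  obtain n \<rho> where \<rho>: "irreducible_representation G n \<rho>" "\<chi> = restrict (\<lambda>g. mat_trace (\<rho> g)) (carrier G)"
    using chi by (auto simp: irreducible_characters_def)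
  thus ?thesis
    using representation_iff[OF G, of n \<rho>] group.is_monoid[OF G]
    by (simp add: irreducible_representation_def mat_trace_one monoid.one_closed)
qed

text \<open>For a representation of degree \<open>n\<close> the value of the character at the unit is \<open>n\<close>.\<close>
lemma normalized_irreducible_character_iff:
  assumes G: "group G"
  shows "normalized_irreducible_character G f \<longleftrightarrow>
    (\<exists>n \<rho>. irreducible_representation G n \<rho> \<and> (\<forall>x\<in>carrier G. f x = mat_trace (\<rho> x) / of_nat n))"
proof -
  have one: "\<one>\<^bsub>G\<^esub> \<in> carrier G" using G by (simp add: group.is_monoid monoid.one_closed)
  have tr1: "mat_trace (\<rho> \<one>\<^bsub>G\<^esub>) = of_nat n" if "irreducible_representation G n \<rho>" for n \<rho>
    using that representation_iff[OF G, of n \<rho>] by (simp add: irreducible_representation_def mat_trace_one)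
  show ?thesis
  proof
    assume "normalized_irreducible_character G f"
    then obtain n \<rho> where \<rho>: "irreducible_representation G n \<rho>"
      "\<forall>x\<in>carrier G. f x = restrict (\<lambda>g. mat_trace (\<rho> g)) (carrier G) x / restrict (\<lambda>g. mat_trace (\<rho> g)) (carrier G) \<one>\<^bsub>G\<^esub>"
      by (auto simp: normalized_irreducible_character_def irreducible_characters_def)
    hence "\<forall>x\<in>carrier G. f x = mat_trace (\<rho> x) / of_nat n" using one tr1[OF \<rho>(1)] by simp
    thus "\<exists>n \<rho>. irreducible_representation G n \<rho> \<and> (\<forall>x\<in>carrier G. f x = mat_trace (\<rho> x) / of_nat n)"
      using \<rho>(1) by blast
  next
    assume "\<exists>n \<rho>. irreducible_representation G n \<rho> \<and> (\<forall>x\<in>carrier G. f x = mat_trace (\<rho> x) / of_nat n)"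
    then obtain n \<rho> where \<rho>: "irreducible_representation G n \<rho>"
      "\<forall>x\<in>carrier G. f x = mat_trace (\<rho> x) / of_nat n" by blast
    define \<chi> where "\<chi> = restrict (\<lambda>g. mat_trace (\<rho> g)) (carrier G)"
    have "\<chi> \<in> irreducible_characters G" using \<rho>(1) by (auto simp: \<chi>_def irreducible_characters_def)
    moreover have "\<forall>x\<in>carrier G. f x = \<chi> x / \<chi> \<one>\<^bsub>G\<^esub>"
      using \<rho>(2) one tr1[OF \<rho>(1)] by (simp add: \<chi>_def)
    ultimately show "normalized_irreducible_character G f"
      using irreducible_character_degree[OF G] unfolding normalized_irreducible_character_def by blast
  qed
qed

lemma smult_one_mat_pow: "(c \<cdot>\<^sub>m 1\<^sub>m n) ^\<^sub>m k = (c ^ k) \<cdot>\<^sub>m (1\<^sub>m n :: complex mat)"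
proof (induction k)
  case (Suc k)
  have "(c \<cdot>\<^sub>m 1\<^sub>m n) ^\<^sub>m Suc k = (c ^ k \<cdot>\<^sub>m 1\<^sub>m n) * (c \<cdot>\<^sub>m (1\<^sub>m n :: complex mat))" using Suc by simp
  also have "\<dots> = c ^ k \<cdot>\<^sub>m (c \<cdot>\<^sub>m 1\<^sub>m n)"
    by (subst mult_smult_assoc_mat[of _ n n _ n]) auto
  also have "\<dots> = c ^ Suc k \<cdot>\<^sub>m 1\<^sub>m n" by (intro eq_matI) auto
  finally show ?case .
qed (intro eq_matI; simp)

locale normalized_character = matrix_representation G n \<rho> for G (structure) and n \<rho> +
  fixes f :: "'a \<Rightarrow> complex"
  assumes finite_group: "finite (carrier G)"
    and irr: "irreducible_representation G n \<rho>"
    and f_eq: "x \<in> carrier G \<Longrightarrow> f x = mat_trace (\<rho> x) / of_nat n"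
begin

lemma degree_pos: "n > 0"
  using irr by (simp add: irreducible_representation_def)

lemma extremal_imp_scalar:
  assumes "x \<in> carrier G" "cmod (f x) = 1"
  shows "\<rho> x = f x \<cdot>\<^sub>m 1\<^sub>m n"
proof -
  have "cmod (mat_trace (\<rho> x)) = of_nat n"
    using assms degree_pos by (simp add: f_eq norm_divide)
  thus ?thesis using extremal_trace_scalar[OF finite_group assms(1)] f_eq[OF assms(1)] by simp
qed

lemma scalar_imp_extremal:
  assumes x: "x \<in> carrier G" and c: "\<rho> x = c \<cdot>\<^sub>m 1\<^sub>m n"
  shows "f x = c" "cmod (f x) = 1"
proof -
  show fx: "f x = c" using c degree_pos by (simp add: f_eq[OF x] mat_trace_smult[of _ n] mat_trace_one)
  have "(c ^ Coset.order G) \<cdot>\<^sub>m 1\<^sub>m n = (1\<^sub>m n :: complex mat)"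
    using rep_pow_order(1)[OF finite_group x] by (simp add: c smult_one_mat_pow)
  hence "((c ^ Coset.order G) \<cdot>\<^sub>m 1\<^sub>m n) $$ (0,0) = (1\<^sub>m n :: complex mat) $$ (0,0)" by simp
  hence "c ^ Coset.order G = 1" using degree_pos by simp
  hence "cmod c ^ Coset.order G = 1 ^ Coset.order G" by (simp flip: norm_power)
  thus "cmod (f x) = 1"
    using rep_pow_order(2)[OF finite_group x] power_eq_imp_eq_base[of "cmod c" "Coset.order G" 1] fx by simp
qed

lemma f_one: "f \<one> = 1"
  using f_eq[of \<one>] degree_pos by (simp add: mat_trace_one)

lemma f_eq_one_iff: "x \<in> carrier G \<Longrightarrow> f x = 1 \<longleftrightarrow> \<rho> x = 1\<^sub>m n"
  using extremal_imp_scalar[of x] f_eq[of x] degree_pos by (auto simp: mat_trace_one)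

lemma f_mult:
  assumes "x \<in> carrier G" "cmod (f x) = 1" "y \<in> carrier G"
  shows "f (x \<otimes> y) = f x * f y"
proof -
  have "\<rho> (x \<otimes> y) = f x \<cdot>\<^sub>m \<rho> y"
    unfolding rep_mult[OF assms(1,3)]
    by (subst extremal_imp_scalar[OF assms(1,2)])
      (simp add: mult_smult_assoc_mat[of _ n n _ n] left_mult_one_mat[OF rep_closed[OF assms(3)]] assms)
  thus ?thesis using assms by (simp add: f_eq mat_trace_smult[OF rep_closed])
qed

lemma f_conj:
  assumes "x \<in> carrier G" "g \<in> carrier G"
  shows "f (g \<otimes> x \<otimes> inv g) = f x"
proof -
  have "\<rho> (inv g) * \<rho> g = 1\<^sub>m n" using rep_mult[of "inv g" g] assms by simp
  hence "mat_trace (\<rho> g * \<rho> x * \<rho> (inv g)) = mat_trace (\<rho> x)"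
    using assms by (intro mat_trace_conjugate) auto
  thus ?thesis using assms by (simp add: f_eq rep_mult)
qed

lemma commutator_kernel_iff:
  assumes "x \<in> carrier G" "g \<in> carrier G"
  shows "\<rho> (commutator x g) = 1\<^sub>m n \<longleftrightarrow> \<rho> x * \<rho> g = \<rho> g * \<rho> x"
proof -
  have eq: "commutator x g = (x \<otimes> g) \<otimes> inv (g \<otimes> x)" using assms by (simp add: inv_mult_group m_assoc)
  have "commutator x g \<otimes> (g \<otimes> x) = x \<otimes> g"
    unfolding eq using assms m_assoc[of "x \<otimes> g" "inv (g \<otimes> x)" "g \<otimes> x"] by simp
  hence 1: "\<rho> (commutator x g) * \<rho> (g \<otimes> x) = \<rho> (x \<otimes> g)"
    using rep_mult[of "commutator x g" "g \<otimes> x"] assms by simp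
  have 2: "\<rho> (g \<otimes> x) * \<rho> (inv (g \<otimes> x)) = 1\<^sub>m n" using rep_mult[of "g \<otimes> x" "inv (g \<otimes> x)"] assms by simp
  have 3: "\<rho> (commutator x g) = \<rho> (x \<otimes> g) * \<rho> (inv (g \<otimes> x))" unfolding eq using assms by (intro rep_mult) auto
  have car: "\<rho> (g \<otimes> x) \<in> carrier_mat n n" using assms by simp
  show ?thesis
    unfolding rep_mult[OF assms, symmetric] rep_mult[OF assms(2,1), symmetric]
    using 1 2 3 car by auto
qed

text \<open>If \<open>f\<close> is trivial on all commutators with \<open>x\<close>, then \<open>\<rho> x\<close> commutes with the whole representation,
  and Schur's lemma applies; conversely a scalar matrix has trivial commutators.\<close>
lemma extremal_iff_commutators:
  assumes x: "x \<in> carrier G"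
  shows "cmod (f x) = 1 \<longleftrightarrow> (\<forall>g\<in>carrier G. f (commutator x g) = 1)"
proof
  assume "cmod (f x) = 1"
  hence sc: "\<rho> x = f x \<cdot>\<^sub>m 1\<^sub>m n" by (rule extremal_imp_scalar[OF x])
  show "\<forall>g\<in>carrier G. f (commutator x g) = 1"
  proof
    fix g assume g: "g \<in> carrier G"
    have "(f x \<cdot>\<^sub>m 1\<^sub>m n) * \<rho> g = \<rho> g * (f x \<cdot>\<^sub>m 1\<^sub>m n)"
      using rep_closed[OF g] by (simp add: mult_smult_assoc_mat[of _ n n _ n] mult_smult_distrib[of _ n n _ n])
    thus "f (commutator x g) = 1"
      using commutator_kernel_iff[OF x g] f_eq_one_iff[of "commutator x g"] x g by (simp add: sc[symmetric])
  qed
next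
  assume "\<forall>g\<in>carrier G. f (commutator x g) = 1"
  hence "\<rho> x * \<rho> g = \<rho> g * \<rho> x" if "g \<in> carrier G" for g
    using that commutator_kernel_iff[OF x that] f_eq_one_iff[of "commutator x g"] x by simp
  then obtain c where "\<rho> x = c \<cdot>\<^sub>m 1\<^sub>m n"
    using Schur_scalar[OF group_axioms irr rep_closed[OF x]] by blast
  thus "cmod (f x) = 1" by (rule scalar_imp_extremal(2)[OF x])
qed

end

lemma normalized_irreducible_character_locale:
  assumes G: "group G" and fin: "finite (carrier G)" and f: "normalized_irreducible_character G f"
  obtains n \<rho> where "normalized_character G n \<rho> f"
proof -
  obtain n \<rho> where \<rho>: "irreducible_representation G n \<rho>" "\<forall>x\<in>carrier G. f x = mat_trace (\<rho> x) / of_nat n"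
    using f normalized_irreducible_character_iff[OF G] by blast
  have "normalized_character G n \<rho> f"
    using G fin \<rho> by (intro normalized_character.intro matrix_representation.intro
        matrix_representation_axioms.intro normalized_character_axioms.intro)
      (auto simp: irreducible_representation_def)
  thus ?thesis by (rule that)
qed

lemma common_kernel_normal:
  assumes G: "group G" and fin: "finite (carrier G)"
    and F: "\<And>f. f \<in> F \<Longrightarrow> normalized_irreducible_character G f"
  shows "{x \<in> carrier G. \<forall>f\<in>F. f x = 1} \<lhd> G"
proof -
  interpret group G by fact
  have loc: "f \<one>\<^bsub>G\<^esub> = 1 \<and>
    (\<forall>x\<in>carrier G. \<forall>y\<in>carrier G. f x = 1 \<longrightarrow> f (x \<otimes>\<^bsub>G\<^esub> y) = f y) \<and>
    (\<forall>x\<in>carrier G. \<forall>g\<in>carrier G. f (g \<otimes>\<^bsub>G\<^esub> x \<otimes>\<^bsub>G\<^esub> inv\<^bsub>G\<^esub> g) = f x)" if f: "f \<in> F" for f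
  proof -
    obtain n \<rho> where "normalized_character G n \<rho> f"
      using normalized_irreducible_character_locale[OF G fin F[OF f]] .
    then interpret normalized_character G n \<rho> f .
    show ?thesis using f_one f_mult f_conj by simp
  qed
  have inv: "f (inv\<^bsub>G\<^esub> x) = 1" if "f \<in> F" "x \<in> carrier G" "f x = 1" for f x
  proof -
    have "f (x \<otimes>\<^bsub>G\<^esub> inv\<^bsub>G\<^esub> x) = f (inv\<^bsub>G\<^esub> x)" using loc[OF that(1)] that(2,3) by blast
    thus ?thesis using loc[OF that(1)] that(2) by simp
  qed
  have mult: "f (x \<otimes>\<^bsub>G\<^esub> y) = 1" if "f \<in> F" "x \<in> carrier G" "f x = 1" "y \<in> carrier G" "f y = 1" for f x y
    using loc[OF that(1)] that by simp
  have one: "f \<one>\<^bsub>G\<^esub> = 1" if "f \<in> F" for f using loc[OF that] by blast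
  have conj: "f (g \<otimes>\<^bsub>G\<^esub> x \<otimes>\<^bsub>G\<^esub> inv\<^bsub>G\<^esub> g) = 1" if "f \<in> F" "x \<in> carrier G" "f x = 1" "g \<in> carrier G" for f x g
    using loc[OF that(1)] that by simp
  have "subgroup {x \<in> carrier G. \<forall>f\<in>F. f x = 1} G"
    by (rule subgroupI) (auto simp: inv mult one intro!: exI[of _ "\<one>\<^bsub>G\<^esub>"])
  thus ?thesis by (rule normal_invI) (auto simp: conj)
qed

text \<open>The nontrivial element \<open>N x\<close> of \<open>G / N\<close> is separated from the unit by an irreducible
  representation of \<open>G / N\<close>, which stays irreducible when it is inflated to \<open>G\<close>.\<close>
lemma normalized_irreducible_character_separates:
  assumes G: "group G" and fin: "finite (carrier G)" and N: "N \<lhd> G" and x: "x \<in> carrier G" "x \<notin> N"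
  obtains f where "normalized_irreducible_character G f" "\<And>y. y \<in> N \<Longrightarrow> f y = 1" "f x \<noteq> 1"
proof -
  interpret group G by fact
  interpret N: normal N G by fact
  define Q where "Q = G Mod N"
  have Q: "group Q" unfolding Q_def by (rule N.factorgroup_is_group)
  have finQ: "finite (carrier Q)" using fin by (simp add: Q_def carrier_FactGroup)
  have coset: "N #>\<^bsub>G\<^esub> g \<in> carrier Q" if "g \<in> carrier G" for g
    using that by (simp add: Q_def carrier_FactGroup)
  have "N #>\<^bsub>G\<^esub> x \<noteq> \<one>\<^bsub>Q\<^esub>"
    using coset_join1[OF _ x(1) N.subgroup_axioms] x(2) by (auto simp: Q_def)
  then obtain n \<rho> where \<rho>: "irreducible_representation Q n \<rho>" "\<rho> (N #>\<^bsub>G\<^esub> x) \<noteq> 1\<^sub>m n"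
    using irreducible_representation_separates[OF Q finQ coset[OF x(1)]] by blast
  interpret rQ: matrix_representation Q n \<rho>
    using Q \<rho>(1) by (simp add: matrix_representation_def matrix_representation_axioms_def irreducible_representation_def)
  have n: "n > 0" using \<rho>(1) by (simp add: irreducible_representation_def)
  define \<sigma> where "\<sigma> g = \<rho> (N #>\<^bsub>G\<^esub> g)" for g
  have one: "N = \<one>\<^bsub>Q\<^esub>" by (simp add: Q_def)
  have sN: "\<sigma> y = 1\<^sub>m n" if "y \<in> N" for y
    unfolding \<sigma>_def N.rcos_const[OF G that] using rQ.rep_one one by simp
  have "representation G n \<sigma>"
    unfolding representation_iff[OF G]
  proof (intro conjI ballI)
    show "\<sigma> g \<in> carrier_mat n n" if "g \<in> carrier G" for g
      using coset[OF that] by (simp add: \<sigma>_def)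
    show "\<sigma> \<one>\<^bsub>G\<^esub> = 1\<^sub>m n" by (rule sN) simp
    fix g h assume gh: "g \<in> carrier G" "h \<in> carrier G"
    have "N #>\<^bsub>G\<^esub> (g \<otimes>\<^bsub>G\<^esub> h) = (N #>\<^bsub>G\<^esub> g) \<otimes>\<^bsub>Q\<^esub> (N #>\<^bsub>G\<^esub> h)"
      using gh by (simp add: Q_def N.rcos_sum)
    thus "\<sigma> (g \<otimes>\<^bsub>G\<^esub> h) = \<sigma> g * \<sigma> h"
      using rQ.rep_mult[OF coset[OF gh(1)] coset[OF gh(2)]] by (simp add: \<sigma>_def)
  qed
  moreover have "invariant_subspace Q n \<rho> W" if "invariant_subspace G n \<sigma> W" for W
    using that by (auto simp: invariant_subspace_def \<sigma>_def Q_def carrier_FactGroup)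
  ultimately have "irreducible_representation G n \<sigma>"
    using \<rho>(1) by (auto simp: irreducible_representation_def)
  hence nf: "normalized_irreducible_character G (\<lambda>g. mat_trace (\<sigma> g) / of_nat n)"
    using normalized_irreducible_character_iff[OF G] by blast
  show ?thesis
  proof (rule that[OF nf])
    show "mat_trace (\<sigma> y) / of_nat n = 1" if "y \<in> N" for y
      using sN[OF that] n by (simp add: mat_trace_one)
    show "mat_trace (\<sigma> x) / of_nat n \<noteq> 1"
      using rQ.trace_eq_degree_imp_one[OF finQ coset[OF x(1)]] \<rho>(2) n by (auto simp: \<sigma>_def field_simps)
  qed
qed

section \<open>Perfect pairings of finite abelian groups\<close>

text \<open>Multiplication by \<open>z \<in> J\<close> permutes \<open>J\<close>, so \<open>z ^ card J\<close> fixes the product of all elements of \<open>J\<close>;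
  and there are only \<open>card J\<close> roots of unity of that order.\<close>
lemma finite_mult_closed_roots_of_unity:
  fixes J :: "complex set"
  assumes fin: "finite J" and ne: "J \<noteq> {}" and nz: "0 \<notin> J"
    and closed: "\<And>z w. z \<in> J \<Longrightarrow> w \<in> J \<Longrightarrow> z * w \<in> J"
  shows "J = {z. z ^ card J = 1}"
proof (rule card_subset_eq)
  have d: "card J > 0" using fin ne by (simp add: card_gt_0_iff)
  show "finite {z::complex. z ^ card J = 1}"
    using d by (intro finite_roots_unity) simp
  show "J \<subseteq> {z. z ^ card J = 1}"
  proof
    fix z assume z: "z \<in> J"
    have inj: "inj_on ((*) z) J" using z nz by (auto simp: inj_on_def)
    have "(*) z ` J = J"
      using closed[OF z] by (intro card_subset_eq[OF fin] card_image[OF inj]) auto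
    hence "(\<Prod>w\<in>J. w) = (\<Prod>w\<in>J. z * w)"
      using prod.reindex[OF inj, of "\<lambda>w. w"] by simp
    also have "\<dots> = z ^ card J * (\<Prod>w\<in>J. w)" by (simp add: prod.distrib)
    finally show "z \<in> {z. z ^ card J = 1}" using nz fin by auto
  qed
  show "card J = card {z::complex. z ^ card J = 1}"
    using card_roots_unity_eq[OF d] by simp
qed

definition bimultiplicative ::
  "('a, 'm) monoid_scheme \<Rightarrow> ('b, 'k) monoid_scheme \<Rightarrow> ('a \<Rightarrow> 'b \<Rightarrow> complex) \<Rightarrow> bool" where
  "bimultiplicative A B p \<longleftrightarrow>
     (\<forall>x\<in>carrier A. \<forall>y\<in>carrier B. p x y \<noteq> 0) \<and>
     (\<forall>x\<in>carrier A. \<forall>x'\<in>carrier A. \<forall>y\<in>carrier B. p (x \<otimes>\<^bsub>A\<^esub> x') y = p x y * p x' y) \<and>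
     (\<forall>x\<in>carrier A. \<forall>y\<in>carrier B. \<forall>y'\<in>carrier B. p x (y \<otimes>\<^bsub>B\<^esub> y') = p x y * p x y')"

definition perfect_pairing ::
  "('a, 'm) monoid_scheme \<Rightarrow> ('b, 'k) monoid_scheme \<Rightarrow> ('a \<Rightarrow> 'b \<Rightarrow> complex) \<Rightarrow> bool" where
  "perfect_pairing A B p \<longleftrightarrow> bimultiplicative A B p \<and>
     (\<forall>x\<in>carrier A. (\<forall>y\<in>carrier B. p x y = 1) \<longrightarrow> x = \<one>\<^bsub>A\<^esub>) \<and>
     (\<forall>y\<in>carrier B. (\<forall>x\<in>carrier A. p x y = 1) \<longrightarrow> y = \<one>\<^bsub>B\<^esub>)"

lemma bimultiplicative_swap: "bimultiplicative A B p \<Longrightarrow> bimultiplicative B A (\<lambda>y x. p x y)"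
  by (simp add: bimultiplicative_def)

lemma perfect_pairing_swap: "perfect_pairing A B p \<Longrightarrow> perfect_pairing B A (\<lambda>y x. p x y)"
  by (simp add: perfect_pairing_def bimultiplicative_swap)

lemma bimultiplicative_nonzero:
  "bimultiplicative A B p \<Longrightarrow> x \<in> carrier A \<Longrightarrow> y \<in> carrier B \<Longrightarrow> p x y \<noteq> 0"
  by (simp add: bimultiplicative_def)

lemma bimultiplicative_mult_left:
  "bimultiplicative A B p \<Longrightarrow> x \<in> carrier A \<Longrightarrow> x' \<in> carrier A \<Longrightarrow> y \<in> carrier B \<Longrightarrow>
     p (x \<otimes>\<^bsub>A\<^esub> x') y = p x y * p x' y"
  by (simp add: bimultiplicative_def)

lemma bimultiplicative_one_left:
  assumes "bimultiplicative A B p" "monoid A" "y \<in> carrier B"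
  shows "p \<one>\<^bsub>A\<^esub> y = 1"
  using bimultiplicative_mult_left[OF assms(1), of "\<one>\<^bsub>A\<^esub>" "\<one>\<^bsub>A\<^esub>" y]
    bimultiplicative_nonzero[OF assms(1), of "\<one>\<^bsub>A\<^esub>" y] assms(2,3)
  by (simp add: monoid.one_closed monoid.l_one)

lemma bimultiplicative_pow_left:
  assumes "bimultiplicative A B p" "monoid A" "x \<in> carrier A" "y \<in> carrier B"
  shows "p (x [^]\<^bsub>A\<^esub> (k::nat)) y = p x y ^ k"
  using assms
  by (induction k) (simp_all add: bimultiplicative_one_left monoid.nat_pow_0 monoid.nat_pow_Suc
      bimultiplicative_mult_left monoid.nat_pow_closed)

lemma bimultiplicative_inv_left:
  assumes "bimultiplicative A B p" "group A" "x \<in> carrier A" "y \<in> carrier B"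
  shows "p (inv\<^bsub>A\<^esub> x) y = inverse (p x y)"
proof -
  interpret group A by fact
  have "p (inv\<^bsub>A\<^esub> x) y * p x y = 1"
    using bimultiplicative_mult_left[OF assms(1), of "inv\<^bsub>A\<^esub> x" x y] assms
      bimultiplicative_one_left[OF assms(1) monoid_axioms] by simp
  thus ?thesis by (metis inverse_unique mult.commute)
qed

lemmas bimultiplicative_mult_right = bimultiplicative_mult_left[OF bimultiplicative_swap]
lemmas bimultiplicative_one_right = bimultiplicative_one_left[OF bimultiplicative_swap]
lemmas bimultiplicative_pow_right = bimultiplicative_pow_left[OF bimultiplicative_swap]

lemma bimultiplicative_kernel_subgroup:
  assumes p: "bimultiplicative A B p" and A: "group A" and S: "S \<subseteq> carrier B"
  shows "subgroup {x \<in> carrier A. \<forall>y\<in>S. p x y = 1} A"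
proof -
  interpret group A by fact
  show ?thesis
    using S by (intro subgroupI)
      (auto simp: bimultiplicative_mult_left[OF p] bimultiplicative_inv_left[OF p A] subset_iff
        intro!: exI[of _ "\<one>\<^bsub>A\<^esub>"] bimultiplicative_one_left[OF p monoid_axioms])
qed

text \<open>The values \<open>p a y\<close> form the group of all roots of unity of some order \<open>d\<close>. Then \<open>a ^ d\<close> pairs
  trivially with \<open>B\<close>, hence \<open>a ^ d = 1\<close>; so \<open>d\<close> is a multiple of the order of \<open>a\<close>, and the
  primitive roots of unity of that order are among the values.\<close>
lemma perfect_pairing_primitive_root:
  assumes p: "perfect_pairing A B p" and A: "group A" and B: "group B"
    and fin: "finite (carrier A)" "finite (carrier B)" and a: "a \<in> carrier A"
  obtains b where "b \<in> carrier B" "p a b = cis (2 * pi / of_nat (group.ord A a))"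
proof -
  interpret A: group A by fact
  interpret B: group B by fact
  have bm: "bimultiplicative A B p" using p by (simp add: perfect_pairing_def)
  define n where "n = A.ord a"
  have n: "n > 0" using A.ord_ge_1[OF fin(1) a] by (simp add: n_def)
  define J where "J = p a ` carrier B"
  have J: "J = {z. z ^ card J = 1}"
  proof (rule finite_mult_closed_roots_of_unity)
    show "finite J" "J \<noteq> {}" using fin(2) B.one_closed unfolding J_def by auto
    show "0 \<notin> J" using bimultiplicative_nonzero[OF bm a] by (auto simp: J_def)
    show "z * w \<in> J" if zw: "z \<in> J" "w \<in> J" for z w
    proof -
      obtain y y' where "y \<in> carrier B" "z = p a y" "y' \<in> carrier B" "w = p a y'"
        using zw by (auto simp: J_def)
      hence "z * w = p a (y \<otimes>\<^bsub>B\<^esub> y')" "y \<otimes>\<^bsub>B\<^esub> y' \<in> carrier B"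
        using bimultiplicative_mult_right[OF bm _ _ a] by simp_all
      thus ?thesis unfolding J_def by blast
    qed
  qed
  have d: "card J > 0" using fin(2) B.one_closed unfolding J_def by (auto simp: card_gt_0_iff)
  have "p (a [^]\<^bsub>A\<^esub> card J) y = 1" if y: "y \<in> carrier B" for y
  proof -
    have "p a y \<in> J" using y by (simp add: J_def)
    hence "p a y ^ card J = 1" by (subst (asm) J) simp
    thus ?thesis using bimultiplicative_pow_left[OF bm A.monoid_axioms a y] by simp
  qed
  hence "a [^]\<^bsub>A\<^esub> card J = \<one>\<^bsub>A\<^esub>" using p a by (simp add: perfect_pairing_def)
  hence "n dvd card J" using A.pow_eq_id[OF a] by (simp add: n_def)
  moreover have "cis (2 * pi / of_nat n) ^ n = 1"
    using n by (simp add: DeMoivre)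
  ultimately have "cis (2 * pi / of_nat n) ^ card J = 1"
    by (auto elim!: dvdE simp: power_mult)
  hence "cis (2 * pi / of_nat n) \<in> J" by (subst J) simp
  then obtain y where "y \<in> carrier B" "p a y = cis (2 * pi / of_nat n)" by (auto simp: J_def)
  thus ?thesis using that unfolding n_def by blast
qed

lemma cis_root_power_eq_1_iff:
  assumes "n > 0"
  shows "cis (2 * pi / of_nat n) ^ k = 1 \<longleftrightarrow> n dvd k"
proof
  have root: "cis (2 * pi / of_nat n) ^ n = 1"
    using assms by (simp add: DeMoivre)
  {
    assume "n dvd k"
    thus "cis (2 * pi / of_nat n) ^ k = 1"
      using root by (auto elim!: dvdE simp: power_mult)
  }
  assume k: "cis (2 * pi / of_nat n) ^ k = 1"
  have "cis (2 * pi / of_nat n) ^ k = cis (2 * pi / of_nat n) ^ (n * (k div n) + k mod n)"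
    by simp
  also have "\<dots> = cis (2 * pi / of_nat n) ^ (k mod n)"
    unfolding power_add power_mult root by simp
  finally have "cis (2 * pi / of_nat n) ^ (k mod n) = 1" using k by simp
  moreover have "cis (2 * pi / of_nat n) ^ j = cis (2 * pi * real j / real n)" for j
    by (simp add: DeMoivre mult_ac)
  ultimately have "cis (2 * pi * real (k mod n) / real n) = cis (2 * pi * real 0 / real n)"
    by (simp only:) simp
  hence "k mod n = 0"
    by (rule inj_onD[OF bij_betw_imp_inj_on[OF bij_betw_roots_unity[OF assms]]]) (use assms in simp_all)
  thus "n dvd k" by auto
qed

lemma root_of_unity_is_cis_power:
  assumes "n > 0" "z ^ n = 1"
  obtains k where "z = cis (2 * pi / of_nat n) ^ k"
proof -
  have "z \<in> (\<lambda>k. cis (2 * pi * real k / real n)) ` {..<n}"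
    using bij_betw_imp_surj_on[OF bij_betw_roots_unity[OF assms(1)]] assms(2) by simp
  then obtain k where "z = cis (2 * pi * real k / real n)" by blast
  hence "z = cis (2 * pi / of_nat n) ^ k" by (simp add: DeMoivre mult_ac)
  thus ?thesis by (rule that)
qed

lemma perfect_pairing_ord_dvd:
  assumes p: "perfect_pairing A B p" and A: "group A" and B: "group B"
    and a: "a \<in> carrier A" and b: "b \<in> carrier B"
    and fin: "finite (carrier A)" and ab: "p a b = cis (2 * pi / of_nat (group.ord A a))"
  shows "group.ord A a dvd group.ord B b"
proof -
  interpret A: group A by fact
  interpret B: group B by fact
  have bm: "bimultiplicative A B p" using p by (simp add: perfect_pairing_def)
  have "p a b ^ B.ord b = 1"
    using bimultiplicative_pow_right[OF bm B.monoid_axioms b a, of "B.ord b"] 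
      bimultiplicative_one_right[OF bm B.monoid_axioms a] b by simp
  thus ?thesis
    using cis_root_power_eq_1_iff[of "A.ord a"] A.ord_ge_1[OF fin a] ab by simp
qed

text \<open>Both groups are internal direct products, \<open>A = \<langle>a\<rangle> \<times> C\<close> and \<open>B = \<langle>b\<rangle> \<times> D\<close>, with cyclic factors of
  the same order \<open>n\<close>; an isomorphism \<open>f\<close> from \<open>C\<close> to \<open>D\<close> extends by \<open>a ^ k * c \<mapsto> b ^ k * f c\<close>.\<close>
lemma iso_by_cyclic_splitting:
  fixes a :: 'a and b :: 'b
  assumes A: "comm_group A" and B: "comm_group B" and a: "a \<in> carrier A" and b: "b \<in> carrier B"
    and C: "subgroup C A" and D: "subgroup D B"
    and n: "a [^]\<^bsub>A\<^esub> n = \<one>\<^bsub>A\<^esub>" "b [^]\<^bsub>B\<^esub> n = \<one>\<^bsub>B\<^esub>"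
    and splitA: "\<And>x. x \<in> carrier A \<Longrightarrow> \<exists>k. \<exists>c\<in>C. x = a [^]\<^bsub>A\<^esub> (k::nat) \<otimes>\<^bsub>A\<^esub> c"
    and splitB: "\<And>y. y \<in> carrier B \<Longrightarrow> \<exists>k. \<exists>d\<in>D. y = b [^]\<^bsub>B\<^esub> (k::nat) \<otimes>\<^bsub>B\<^esub> d"
    and meetA: "\<And>k. a [^]\<^bsub>A\<^esub> (k::nat) \<in> C \<Longrightarrow> n dvd k"
    and meetB: "\<And>k. b [^]\<^bsub>B\<^esub> (k::nat) \<in> D \<Longrightarrow> n dvd k"
    and iso: "A\<lparr>carrier := C\<rparr> \<cong> B\<lparr>carrier := D\<rparr>"
  shows "A \<cong> B"
proof -
  interpret A: comm_group A by fact
  interpret B: comm_group B by fact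
  interpret C: subgroup C A by fact
  interpret D: subgroup D B by fact
  obtain f where f: "f \<in> iso (A\<lparr>carrier := C\<rparr>) (B\<lparr>carrier := D\<rparr>)"
    using iso by (auto simp: is_iso_def)
  hence fbij: "bij_betw f C D"
    and fmult: "\<And>x y. x \<in> C \<Longrightarrow> y \<in> C \<Longrightarrow> f (x \<otimes>\<^bsub>A\<^esub> y) = f x \<otimes>\<^bsub>B\<^esub> f y"
    by (auto simp: iso_def hom_def)
  have fD: "f c \<in> D" if "c \<in> C" for c using fbij that by (auto simp: bij_betw_def)
  have f1: "f \<one>\<^bsub>A\<^esub> = \<one>\<^bsub>B\<^esub>"
  proof -
    have "f \<one>\<^bsub>A\<^esub> \<otimes>\<^bsub>B\<^esub> f \<one>\<^bsub>A\<^esub> = f \<one>\<^bsub>A\<^esub>"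
      using fmult[of "\<one>\<^bsub>A\<^esub>" "\<one>\<^bsub>A\<^esub>", symmetric] by simp
    moreover have "f \<one>\<^bsub>A\<^esub> \<in> carrier B" using D.mem_carrier[OF fD[OF C.one_closed]] .
    ultimately show ?thesis using B.l_cancel_one by blast
  qed
  have perA: "a [^]\<^bsub>A\<^esub> k = \<one>\<^bsub>A\<^esub>" if "n dvd k" for k :: nat
    using that A.pow_eq_id[OF a, of n] A.pow_eq_id[OF a, of k] n dvd_trans[of _ n k] by simp
  have perB: "b [^]\<^bsub>B\<^esub> k = \<one>\<^bsub>B\<^esub>" if "n dvd k" for k :: nat
    using that B.pow_eq_id[OF b, of n] B.pow_eq_id[OF b, of k] n dvd_trans[of _ n k] by simp
  have uniq: "c = c' \<and> b [^]\<^bsub>B\<^esub> k = b [^]\<^bsub>B\<^esub> l"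
    if cc: "c \<in> C" "c' \<in> C" and kl: "k \<ge> l" and eq: "a [^]\<^bsub>A\<^esub> k \<otimes>\<^bsub>A\<^esub> c = a [^]\<^bsub>A\<^esub> l \<otimes>\<^bsub>A\<^esub> c'"
    for c c' and k l :: nat
  proof -
    have "a [^]\<^bsub>A\<^esub> k = a [^]\<^bsub>A\<^esub> l \<otimes>\<^bsub>A\<^esub> a [^]\<^bsub>A\<^esub> (k - l)"
      using kl a by (simp add: A.nat_pow_mult)
    hence "a [^]\<^bsub>A\<^esub> l \<otimes>\<^bsub>A\<^esub> (a [^]\<^bsub>A\<^esub> (k - l) \<otimes>\<^bsub>A\<^esub> c) = a [^]\<^bsub>A\<^esub> l \<otimes>\<^bsub>A\<^esub> c'"
      using eq cc a by (simp add: A.m_assoc)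
    hence ac: "a [^]\<^bsub>A\<^esub> (k - l) \<otimes>\<^bsub>A\<^esub> c = c'" using cc a by simp
    have "a [^]\<^bsub>A\<^esub> (k - l) = c' \<otimes>\<^bsub>A\<^esub> inv\<^bsub>A\<^esub> c"
      unfolding ac[symmetric] using cc(1) a by (simp add: A.m_assoc)
    hence "a [^]\<^bsub>A\<^esub> (k - l) \<in> C" using cc by simp
    hence dv: "n dvd (k - l)" by (rule meetA)
    have "b [^]\<^bsub>B\<^esub> k = b [^]\<^bsub>B\<^esub> l \<otimes>\<^bsub>B\<^esub> b [^]\<^bsub>B\<^esub> (k - l)"
      using kl b by (simp add: B.nat_pow_mult)
    thus ?thesis using ac perA[OF dv] perB[OF dv] cc b by simp
  qed
  define F where "F x = (SOME y. \<exists>k. \<exists>c\<in>C. x = a [^]\<^bsub>A\<^esub> (k::nat) \<otimes>\<^bsub>A\<^esub> c \<and> y = b [^]\<^bsub>B\<^esub> k \<otimes>\<^bsub>B\<^esub> f c)" for x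
  have F: "F (a [^]\<^bsub>A\<^esub> k \<otimes>\<^bsub>A\<^esub> c) = b [^]\<^bsub>B\<^esub> k \<otimes>\<^bsub>B\<^esub> f c" if c: "c \<in> C" for k :: nat and c
    unfolding F_def
  proof (rule some_equality)
    show "\<exists>l. \<exists>c'\<in>C. a [^]\<^bsub>A\<^esub> k \<otimes>\<^bsub>A\<^esub> c = a [^]\<^bsub>A\<^esub> (l::nat) \<otimes>\<^bsub>A\<^esub> c' \<and> b [^]\<^bsub>B\<^esub> k \<otimes>\<^bsub>B\<^esub> f c = b [^]\<^bsub>B\<^esub> l \<otimes>\<^bsub>B\<^esub> f c'"
      using c by (intro exI[of _ k] bexI[of _ c]) auto
    fix y assume "\<exists>l. \<exists>c'\<in>C. a [^]\<^bsub>A\<^esub> k \<otimes>\<^bsub>A\<^esub> c = a [^]\<^bsub>A\<^esub> l \<otimes>\<^bsub>A\<^esub> c' \<and> y = b [^]\<^bsub>B\<^esub> (l::nat) \<otimes>\<^bsub>B\<^esub> f c'"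
    then obtain l :: nat and c' where lc: "c' \<in> C" "a [^]\<^bsub>A\<^esub> k \<otimes>\<^bsub>A\<^esub> c = a [^]\<^bsub>A\<^esub> l \<otimes>\<^bsub>A\<^esub> c'"
      "y = b [^]\<^bsub>B\<^esub> l \<otimes>\<^bsub>B\<^esub> f c'" by blast
    have "c = c' \<and> b [^]\<^bsub>B\<^esub> k = b [^]\<^bsub>B\<^esub> l"
    proof (cases "l \<le> k")
      case True
      show ?thesis by (rule uniq[OF c lc(1) True lc(2)])
    next
      case False
      hence "k \<le> l" by simp
      from uniq[OF lc(1) c this lc(2)[symmetric]] show ?thesis by simp
    qed
    thus "y = b [^]\<^bsub>B\<^esub> k \<otimes>\<^bsub>B\<^esub> f c" unfolding lc(3) by simp
  qed
  have "F \<in> iso A B"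
  proof (rule isoI)
    show hom: "F \<in> hom A B"
    proof (rule homI)
      fix x y assume xy: "x \<in> carrier A" "y \<in> carrier A"
      obtain k c where x: "x = a [^]\<^bsub>A\<^esub> (k::nat) \<otimes>\<^bsub>A\<^esub> c" "c \<in> C" using splitA[OF xy(1)] by blast
      obtain l c' where y: "y = a [^]\<^bsub>A\<^esub> (l::nat) \<otimes>\<^bsub>A\<^esub> c'" "c' \<in> C" using splitA[OF xy(2)] by blast
      show "F x \<in> carrier B"
        using D.mem_carrier[OF fD[OF x(2)]] b unfolding x(1) F[OF x(2)] by simp
      have "x \<otimes>\<^bsub>A\<^esub> y = (a [^]\<^bsub>A\<^esub> k \<otimes>\<^bsub>A\<^esub> a [^]\<^bsub>A\<^esub> l) \<otimes>\<^bsub>A\<^esub> (c \<otimes>\<^bsub>A\<^esub> c')"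
        using C.mem_carrier[OF x(2)] C.mem_carrier[OF y(2)] a unfolding x(1) y(1)
        by (simp add: A.m_assoc A.m_lcomm)
      also have "\<dots> = a [^]\<^bsub>A\<^esub> (k + l) \<otimes>\<^bsub>A\<^esub> (c \<otimes>\<^bsub>A\<^esub> c')" using a by (simp add: A.nat_pow_mult)
      finally have "F (x \<otimes>\<^bsub>A\<^esub> y) = b [^]\<^bsub>B\<^esub> (k + l) \<otimes>\<^bsub>B\<^esub> (f c \<otimes>\<^bsub>B\<^esub> f c')"
        using F[of "c \<otimes>\<^bsub>A\<^esub> c'" "k + l"] x(2) y(2) by (simp add: fmult)
      also have "\<dots> = (b [^]\<^bsub>B\<^esub> k \<otimes>\<^bsub>B\<^esub> b [^]\<^bsub>B\<^esub> l) \<otimes>\<^bsub>B\<^esub> (f c \<otimes>\<^bsub>B\<^esub> f c')" using b by (simp add: B.nat_pow_mult)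
      also have "\<dots> = F x \<otimes>\<^bsub>B\<^esub> F y"
        using D.mem_carrier[OF fD[OF x(2)]] D.mem_carrier[OF fD[OF y(2)]] b
        unfolding x(1) y(1) F[OF x(2)] F[OF y(2)] by (simp add: B.m_assoc B.m_lcomm)
      finally show "F (x \<otimes>\<^bsub>A\<^esub> y) = F x \<otimes>\<^bsub>B\<^esub> F y" .
    qed
    show "bij_betw F (carrier A) (carrier B)"
    proof (rule bij_betw_imageI)
      show "inj_on F (carrier A)"
      proof (rule inj_on_one_iff'[OF hom A.group_axioms B.group_axioms, THEN iffD2], intro allI impI)
        fix x assume "x \<in> carrier A" and Fx: "F x = \<one>\<^bsub>B\<^esub>"
        then obtain k c where x: "x = a [^]\<^bsub>A\<^esub> (k::nat) \<otimes>\<^bsub>A\<^esub> c" "c \<in> C" using splitA by blast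
        have bfc: "b [^]\<^bsub>B\<^esub> k \<otimes>\<^bsub>B\<^esub> f c = \<one>\<^bsub>B\<^esub>" using Fx F[OF x(2)] unfolding x(1) by simp
        have "inv\<^bsub>B\<^esub> (f c) = b [^]\<^bsub>B\<^esub> k"
          using b D.mem_carrier[OF fD[OF x(2)]] by (intro B.inv_equality[OF bfc]) auto
        hence bk: "b [^]\<^bsub>B\<^esub> k \<in> D" using D.m_inv_closed[OF fD[OF x(2)]] by simp
        hence "n dvd k" by (rule meetB)
        hence ab: "b [^]\<^bsub>B\<^esub> k = \<one>\<^bsub>B\<^esub>" "a [^]\<^bsub>A\<^esub> k = \<one>\<^bsub>A\<^esub>" using perA perB by auto
        have "f c = f \<one>\<^bsub>A\<^esub>"
          using bfc D.mem_carrier[OF fD[OF x(2)]] unfolding ab f1 by simp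
        hence "c = \<one>\<^bsub>A\<^esub>"
          by (rule inj_onD[OF bij_betw_imp_inj_on[OF fbij]]) (use x(2) in auto)
        thus "x = \<one>\<^bsub>A\<^esub>" unfolding x(1) ab by simp
      qed
      show "F ` carrier A = carrier B"
      proof (intro equalityI subsetI)
        fix y assume "y \<in> carrier B"
        then obtain k d where y: "y = b [^]\<^bsub>B\<^esub> (k::nat) \<otimes>\<^bsub>B\<^esub> d" "d \<in> D" using splitB by blast
        then obtain c where c: "c \<in> C" "d = f c" using fbij by (auto simp: bij_betw_def)
        have "y = F (a [^]\<^bsub>A\<^esub> k \<otimes>\<^bsub>A\<^esub> c)" unfolding F[OF c(1)] y(1) c(2) ..
        moreover have "a [^]\<^bsub>A\<^esub> k \<otimes>\<^bsub>A\<^esub> c \<in> carrier A" using a C.mem_carrier[OF c(1)] by simp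
        ultimately show "y \<in> F ` carrier A" by blast
      qed (use hom in \<open>auto simp: hom_def\<close>)
    qed
  qed
  thus ?thesis by (auto simp: is_iso_def)
qed

lemma (in comm_group) subgroup_is_comm_group:
  assumes "subgroup H G"
  shows "comm_group (G\<lparr>carrier := H\<rparr>)"
proof (rule group.group_comm_groupI[OF subgroup_imp_group[OF assms]])
  fix x y assume "x \<in> carrier (G\<lparr>carrier := H\<rparr>)" "y \<in> carrier (G\<lparr>carrier := H\<rparr>)"
  thus "x \<otimes>\<^bsub>G\<lparr>carrier := H\<rparr>\<^esub> y = y \<otimes>\<^bsub>G\<lparr>carrier := H\<rparr>\<^esub> x"
    using subgroup.mem_carrier[OF assms] m_comm by simp
qed

text \<open>Since \<open>b\<close> has order dividing \<open>n\<close>, the value \<open>p x b\<close> is a power \<open>p a b ^ k\<close>, and dividing \<open>x\<close> by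
  \<open>a ^ k\<close> leaves an element orthogonal to \<open>b\<close>.\<close>
lemma perfect_pairing_split:
  assumes p: "perfect_pairing A B p" and A: "comm_group A" and B: "group B"
    and a: "a \<in> carrier A" and b: "b \<in> carrier B" and x: "x \<in> carrier A" and n: "n > 0"
    and ab: "p a b = cis (2 * pi / of_nat n)" and bn: "b [^]\<^bsub>B\<^esub> n = \<one>\<^bsub>B\<^esub>"
  shows "\<exists>k. \<exists>c\<in>{x\<in>carrier A. p x b = 1}. x = a [^]\<^bsub>A\<^esub> (k::nat) \<otimes>\<^bsub>A\<^esub> c"
proof -
  interpret A: comm_group A by fact
  interpret B: group B by fact
  have bm: "bimultiplicative A B p" using p by (simp add: perfect_pairing_def)
  have "p x b ^ n = 1"
    using bimultiplicative_pow_right[OF bm B.monoid_axioms b x, of n]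
      bimultiplicative_one_right[OF bm B.monoid_axioms x] bn by simp
  then obtain k where k: "p x b = cis (2 * pi / of_nat n) ^ k" using root_of_unity_is_cis_power n by blast
  define c where "c = inv\<^bsub>A\<^esub> (a [^]\<^bsub>A\<^esub> k) \<otimes>\<^bsub>A\<^esub> x"
  have "p c b = 1"
    unfolding c_def using a b x k ab
    by (simp add: bimultiplicative_mult_left[OF bm] bimultiplicative_inv_left[OF bm A.group_axioms]
        bimultiplicative_pow_left[OF bm A.monoid_axioms])
  moreover have "x = a [^]\<^bsub>A\<^esub> k \<otimes>\<^bsub>A\<^esub> c" "c \<in> carrier A" using a x by (simp_all add: c_def flip: A.m_assoc)
  ultimately show ?thesis by blast
qed

text \<open>By the splitting of \<open>B\<close>, an element of \<open>A\<close> that is orthogonal to \<open>b\<close> and to all of \<open>a\<^sup>\<bottom>\<close> is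
  orthogonal to \<open>B\<close>.\<close>
lemma perfect_pairing_restrict:
  assumes p: "perfect_pairing A B p" and A: "comm_group A" and B: "comm_group B"
    and a: "a \<in> carrier A" and b: "b \<in> carrier B" and n: "n > 0"
    and ab: "p a b = cis (2 * pi / of_nat n)" and an: "a [^]\<^bsub>A\<^esub> n = \<one>\<^bsub>A\<^esub>" and bn: "b [^]\<^bsub>B\<^esub> n = \<one>\<^bsub>B\<^esub>"
  shows "perfect_pairing (A\<lparr>carrier := {x\<in>carrier A. p x b = 1}\<rparr>) (B\<lparr>carrier := {y\<in>carrier B. p a y = 1}\<rparr>) p"
proof -
  interpret A: comm_group A by fact
  interpret B: comm_group B by fact
  have bm: "bimultiplicative A B p" using p by (simp add: perfect_pairing_def)
  have 1: "x = \<one>\<^bsub>A\<^esub>" if x: "x \<in> carrier A" "p x b = 1" and "\<forall>y\<in>carrier B. p a y = 1 \<longrightarrow> p x y = 1" for x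
  proof -
    have "p x y = 1" if y: "y \<in> carrier B" for y
    proof -
      obtain k d where "y = b [^]\<^bsub>B\<^esub> (k::nat) \<otimes>\<^bsub>B\<^esub> d" "d \<in> carrier B" "p a d = 1"
        using perfect_pairing_split[OF perfect_pairing_swap[OF p] B A.group_axioms b a y n ab an] by blast
      thus ?thesis using that x b \<open>\<forall>y\<in>carrier B. p a y = 1 \<longrightarrow> p x y = 1\<close>
        by (simp add: bimultiplicative_mult_right[OF bm] bimultiplicative_pow_right[OF bm B.monoid_axioms])
    qed
    thus ?thesis using p x by (simp add: perfect_pairing_def)
  qed
  have 2: "y = \<one>\<^bsub>B\<^esub>" if y: "y \<in> carrier B" "p a y = 1" and "\<forall>x\<in>carrier A. p x b = 1 \<longrightarrow> p x y = 1" for y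
  proof -
    have "p x y = 1" if x: "x \<in> carrier A" for x
    proof -
      obtain k c where "x = a [^]\<^bsub>A\<^esub> (k::nat) \<otimes>\<^bsub>A\<^esub> c" "c \<in> carrier A" "p c b = 1"
        using perfect_pairing_split[OF p A B.group_axioms a b x n ab bn] by blast
      thus ?thesis using that y a \<open>\<forall>x\<in>carrier A. p x b = 1 \<longrightarrow> p x y = 1\<close>
        by (simp add: bimultiplicative_mult_left[OF bm] bimultiplicative_pow_left[OF bm A.monoid_axioms])
    qed
    thus ?thesis using p y by (simp add: perfect_pairing_def)
  qed
  show ?thesis
    using bm 1 2 unfolding perfect_pairing_def bimultiplicative_def by simp
qed

text \<open>Take \<open>a \<in> A\<close> of maximal order \<open>n\<close> and \<open>b \<in> B\<close> such that \<open>p a b\<close> is a primitive \<open>n\<close>-th root of unity.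
  Then \<open>a\<close> and \<open>b\<close> split off as cyclic direct factors of order \<open>n\<close>, with complements \<open>b\<^sup>\<bottom>\<close> and
  \<open>a\<^sup>\<bottom>\<close>. These are again perfectly paired, so induction applies.\<close>
lemma perfect_pairing_iso:
  fixes A :: "('a, 'm) monoid_scheme" and B :: "('b, 'k) monoid_scheme"
  assumes "perfect_pairing A B p" "comm_group A" "comm_group B" "finite (carrier A)" "finite (carrier B)"
  shows "A \<cong> B"
  using assms
proof (induction "card (carrier A)" arbitrary: A B rule: less_induct)
  case less
  note p = less.prems(1) and fin = less.prems(4,5)
  interpret A: comm_group A by (rule less.prems)
  interpret B: comm_group B by (rule less.prems)
  have bm: "bimultiplicative A B p" using p by (simp add: perfect_pairing_def)
  have "Max (A.ord ` carrier A) \<in> A.ord ` carrier A"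
    using fin(1) A.one_closed by (intro Max_in) auto
  then obtain a where a: "a \<in> carrier A" and "A.ord a = Max (A.ord ` carrier A)" by auto
  hence amax: "A.ord x \<le> A.ord a" if "x \<in> carrier A" for x
    using that fin(1) by simp
  define n where "n = A.ord a"
  have n: "n > 0" using A.ord_ge_1[OF fin(1) a] by (simp add: n_def)
  obtain b where b: "b \<in> carrier B" and ab: "p a b = cis (2 * pi / of_nat n)"
    using perfect_pairing_primitive_root[OF p A.group_axioms B.group_axioms fin a] unfolding n_def by blast
  \<comment> \<open>The order of \<open>b\<close> is a multiple of \<open>n\<close>, and it divides the order of some \<open>a' \<in> A\<close>; so the maximality
    of \<open>n\<close> forces equality.\<close>
  have "B.ord b = n"
  proof -
    obtain a' where a': "a' \<in> carrier A" "p a' b = cis (2 * pi / of_nat (B.ord b))"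
      using perfect_pairing_primitive_root[OF perfect_pairing_swap[OF p] B.group_axioms A.group_axioms fin(2,1) b] by blast
    have "B.ord b dvd A.ord a'"
      using perfect_pairing_ord_dvd[OF perfect_pairing_swap[OF p] B.group_axioms A.group_axioms b a'(1) fin(2) a'(2)] .
    hence "B.ord b \<le> n"
      using amax[OF a'(1)] A.ord_ge_1[OF fin(1) a'(1)] dvd_imp_le[of "B.ord b" "A.ord a'"]
      unfolding n_def by linarith
    moreover have "n dvd B.ord b"
      using perfect_pairing_ord_dvd[OF p A.group_axioms B.group_axioms a b fin(1)] ab unfolding n_def .
    ultimately show ?thesis using B.ord_ge_1[OF fin(2) b] by (simp add: dvd_imp_le le_antisym)
  qed
  hence bn: "b [^]\<^bsub>B\<^esub> n = \<one>\<^bsub>B\<^esub>" using B.pow_ord_eq_1[OF b] by simp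
  have an: "a [^]\<^bsub>A\<^esub> n = \<one>\<^bsub>A\<^esub>" using a by (simp add: n_def)
  define C where "C = {x\<in>carrier A. p x b = 1}"
  define D where "D = {y\<in>carrier B. p a y = 1}"
  have C: "subgroup C A" using bimultiplicative_kernel_subgroup[OF bm A.group_axioms, of "{b}"] b by (simp add: C_def)
  have D: "subgroup D B"
    using bimultiplicative_kernel_subgroup[OF bimultiplicative_swap[OF bm] B.group_axioms, of "{a}"] a by (simp add: D_def)
  show ?case
  proof (cases "n = 1")
    case True
    have A1: "x = \<one>\<^bsub>A\<^esub>" if "x \<in> carrier A" for x
      using amax[OF that] A.ord_ge_1[OF fin(1) that] True A.ord_eq_1[OF that] by (simp add: n_def)
    have B1: "y = \<one>\<^bsub>B\<^esub>" if "y \<in> carrier B" for y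
      using p that A1 bimultiplicative_one_left[OF bm A.monoid_axioms that]
      unfolding perfect_pairing_def by auto
    have "(\<lambda>_. \<one>\<^bsub>B\<^esub>) \<in> iso A B"
      using A1 B1 by (intro isoI homI) (auto simp: bij_betw_def inj_on_def)
    thus ?thesis by (auto simp: is_iso_def)
  next
    case False
    have "a \<notin> C" using ab cis_root_power_eq_1_iff[OF n, of 1] False by (auto simp: C_def)
    hence "card C < card (carrier A)"
      using a by (intro psubset_card_mono fin) (auto simp: C_def)
    have iso: "A\<lparr>carrier := C\<rparr> \<cong> B\<lparr>carrier := D\<rparr>"
    proof (rule less.hyps)
      show "perfect_pairing (A\<lparr>carrier := C\<rparr>) (B\<lparr>carrier := D\<rparr>) p"
        unfolding C_def D_def using perfect_pairing_restrict[OF p] a b n ab an bn A.comm_group_axioms B.comm_group_axioms by blast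
      show "comm_group (A\<lparr>carrier := C\<rparr>)" "comm_group (B\<lparr>carrier := D\<rparr>)"
        using A.subgroup_is_comm_group[OF C] B.subgroup_is_comm_group[OF D] by auto
    qed (use fin \<open>card C < card (carrier A)\<close> in \<open>auto simp: C_def D_def\<close>)
    show ?thesis
    proof (rule iso_by_cyclic_splitting[OF A.comm_group_axioms B.comm_group_axioms a b C D an bn _ _ _ _ iso])
      show "\<exists>k. \<exists>c\<in>C. x = a [^]\<^bsub>A\<^esub> (k::nat) \<otimes>\<^bsub>A\<^esub> c" if "x \<in> carrier A" for x
        unfolding C_def using perfect_pairing_split[OF p A.comm_group_axioms B.group_axioms a b that n ab bn] .
      show "\<exists>k. \<exists>d\<in>D. y = b [^]\<^bsub>B\<^esub> (k::nat) \<otimes>\<^bsub>B\<^esub> d" if "y \<in> carrier B" for y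
        unfolding D_def
        using perfect_pairing_split[OF perfect_pairing_swap[OF p] B.comm_group_axioms A.group_axioms b a that n ab an] .
      show "n dvd k" if "a [^]\<^bsub>A\<^esub> k \<in> C" for k :: nat
        using that bimultiplicative_pow_left[OF bm A.monoid_axioms a b] ab cis_root_power_eq_1_iff[OF n]
        by (simp add: C_def)
      show "n dvd k" if "b [^]\<^bsub>B\<^esub> k \<in> D" for k :: nat
        using that bimultiplicative_pow_right[OF bm B.monoid_axioms b a] ab cis_root_power_eq_1_iff[OF n]
        by (simp add: D_def)
    qed
  qed
qed

text \<open>The factor group is abelian because commutators pair trivially with \<open>B\<close>: the values of \<open>p\<close> lie in
  a commutative group.\<close>
lemma bimultiplicative_factor_comm_group:
  assumes p: "bimultiplicative A B p" and A: "group A"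
    and N: "N = {x \<in> carrier A. \<forall>y\<in>carrier B. p x y = 1}"
  shows "N \<lhd> A" "comm_group (A Mod N)"
proof -
  interpret group A by fact
  have N_iff: "x \<in> N \<longleftrightarrow> x \<in> carrier A \<and> (\<forall>y\<in>carrier B. p x y = 1)" for x using N by simp
  note p_simps = bimultiplicative_mult_left[OF p] bimultiplicative_inv_left[OF p A]
    bimultiplicative_nonzero[OF p]
  have sub: "subgroup N A" unfolding N by (rule bimultiplicative_kernel_subgroup[OF p A]) simp
  show norm: "N \<lhd> A"
    by (rule normal_invI[OF sub]) (auto simp: N_iff p_simps)
  interpret N: normal N A by (rule norm)
  show "comm_group (A Mod N)"
  proof (rule group.group_comm_groupI[OF N.factorgroup_is_group])
    fix X Y assume "X \<in> carrier (A Mod N)" "Y \<in> carrier (A Mod N)"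
    then obtain x y where x: "x \<in> carrier A" "X = N #>\<^bsub>A\<^esub> x" and y: "y \<in> carrier A" "Y = N #>\<^bsub>A\<^esub> y"
      by (auto simp: carrier_FactGroup)
    have "p ((x \<otimes>\<^bsub>A\<^esub> y) \<otimes>\<^bsub>A\<^esub> inv\<^bsub>A\<^esub> (y \<otimes>\<^bsub>A\<^esub> x)) z = 1" if z: "z \<in> carrier B" for z
    proof -
      have "p ((x \<otimes>\<^bsub>A\<^esub> y) \<otimes>\<^bsub>A\<^esub> inv\<^bsub>A\<^esub> (y \<otimes>\<^bsub>A\<^esub> x)) z = (p x z * p y z) * inverse (p y z * p x z)"
        using x(1) y(1) z by (simp add: bimultiplicative_mult_left[OF p] bimultiplicative_inv_left[OF p A])
      thus ?thesis
        using bimultiplicative_nonzero[OF p x(1) z] bimultiplicative_nonzero[OF p y(1) z]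
        by (simp add: field_simps)
    qed
    hence "(x \<otimes>\<^bsub>A\<^esub> y) \<otimes>\<^bsub>A\<^esub> inv\<^bsub>A\<^esub> (y \<otimes>\<^bsub>A\<^esub> x) \<in> N"
      using x(1) y(1) by (simp add: N_iff)
    hence "N #>\<^bsub>A\<^esub> (x \<otimes>\<^bsub>A\<^esub> y) = N #>\<^bsub>A\<^esub> (y \<otimes>\<^bsub>A\<^esub> x)"
      using x(1) y(1) N.rcos_module[OF A, of "y \<otimes>\<^bsub>A\<^esub> x" "x \<otimes>\<^bsub>A\<^esub> y"] repr_independence[OF _ _ sub] by auto
    thus "X \<otimes>\<^bsub>A Mod N\<^esub> Y = Y \<otimes>\<^bsub>A Mod N\<^esub> X"
      using x y by (simp add: N.rcos_sum)
  qed
qed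

text \<open>Modulo its two kernels a bimultiplicative map becomes a perfect pairing.\<close>
lemma bimultiplicative_factor_iso:
  assumes p: "bimultiplicative A B p" and A: "group A" and B: "group B"
    and fin: "finite (carrier A)" "finite (carrier B)"
    and N: "N = {x \<in> carrier A. \<forall>y\<in>carrier B. p x y = 1}"
    and L: "L = {y \<in> carrier B. \<forall>x\<in>carrier A. p x y = 1}"
  shows "A Mod N \<cong> B Mod L"
proof -
  interpret A: group A by fact
  interpret B: group B by fact
  interpret N: normal N A by (rule bimultiplicative_factor_comm_group[OF p A N])
  interpret L: normal L B by (rule bimultiplicative_factor_comm_group[OF bimultiplicative_swap[OF p] B L])
  \<comment> \<open>The value does not depend on the chosen representatives of the cosets.\<close>
  define q where "q X Y = p (SOME x. x \<in> X) (SOME y. y \<in> Y)" for X Y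
  have NI: "m \<in> carrier A" "\<And>y. y \<in> carrier B \<Longrightarrow> p m y = 1" if "m \<in> N" for m
    using that unfolding N by auto
  have LI: "l \<in> carrier B" "\<And>x. x \<in> carrier A \<Longrightarrow> p x l = 1" if "l \<in> L" for l
    using that unfolding L by auto
  have rep: "p z y = p x y" if xy: "x \<in> carrier A" "y \<in> carrier B" and z: "z \<in> N #>\<^bsub>A\<^esub> x" for x y z
  proof -
    obtain m where m: "m \<in> N" "z = m \<otimes>\<^bsub>A\<^esub> x" using z unfolding r_coset_def by blast
    show ?thesis
      unfolding m(2) using bimultiplicative_mult_left[OF p NI(1)[OF m(1)] xy] NI(2)[OF m(1) xy(2)] by simp
  qed
  have rep': "p x z = p x y" if xy: "x \<in> carrier A" "y \<in> carrier B" and z: "z \<in> L #>\<^bsub>B\<^esub> y" for x y z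
  proof -
    obtain l where l: "l \<in> L" "z = l \<otimes>\<^bsub>B\<^esub> y" using z unfolding r_coset_def by blast
    show ?thesis
      unfolding l(2) using bimultiplicative_mult_right[OF p LI(1)[OF l(1)] xy(2,1)] LI(2)[OF l(1) xy(1)] by simp
  qed
  have q: "q (N #>\<^bsub>A\<^esub> x) (L #>\<^bsub>B\<^esub> y) = p x y" if xy: "x \<in> carrier A" "y \<in> carrier B" for x y
  proof -
    have 1: "(SOME x'. x' \<in> N #>\<^bsub>A\<^esub> x) \<in> N #>\<^bsub>A\<^esub> x"
      using A.rcos_self[OF xy(1) N.subgroup_axioms] by (rule someI)
    have 2: "(SOME y'. y' \<in> L #>\<^bsub>B\<^esub> y) \<in> L #>\<^bsub>B\<^esub> y"
      using B.rcos_self[OF xy(2) L.subgroup_axioms] by (rule someI)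
    have "(SOME y'. y' \<in> L #>\<^bsub>B\<^esub> y) \<in> carrier B"
      using 2 B.r_coset_subset_G[OF L.subset xy(2)] by blast
    thus ?thesis unfolding q_def using rep[OF xy(1) _ 1] rep'[OF xy 2] by simp
  qed
  have bi: "bimultiplicative (A Mod N) (B Mod L) q"
    unfolding bimultiplicative_def carrier_FactGroup
    by (auto simp: q N.rcos_sum L.rcos_sum bimultiplicative_nonzero[OF p]
        bimultiplicative_mult_left[OF p] bimultiplicative_mult_right[OF p])
  have "perfect_pairing (A Mod N) (B Mod L) q"
    unfolding perfect_pairing_def
  proof (intro conjI bi ballI impI)
    fix X assume "X \<in> carrier (A Mod N)" and triv: "\<forall>Y\<in>carrier (B Mod L). q X Y = 1"
    then obtain x where x: "x \<in> carrier A" "X = N #>\<^bsub>A\<^esub> x" by (auto simp: carrier_FactGroup)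
    have "p x y = 1" if "y \<in> carrier B" for y
    proof -
      have "L #>\<^bsub>B\<^esub> y \<in> carrier (B Mod L)" using that by (simp add: carrier_FactGroup)
      hence "q X (L #>\<^bsub>B\<^esub> y) = 1" using triv by blast
      thus ?thesis using q[OF x(1) that] x(2) by simp
    qed
    hence "x \<in> N" using x(1) unfolding N by simp
    thus "X = \<one>\<^bsub>A Mod N\<^esub>" using x N.rcos_const[OF A] by simp
  next
    fix Y assume "Y \<in> carrier (B Mod L)" and triv: "\<forall>X\<in>carrier (A Mod N). q X Y = 1"
    then obtain y where y: "y \<in> carrier B" "Y = L #>\<^bsub>B\<^esub> y" by (auto simp: carrier_FactGroup)
    have "p x y = 1" if "x \<in> carrier A" for x
    proof -
      have "N #>\<^bsub>A\<^esub> x \<in> carrier (A Mod N)" using that by (simp add: carrier_FactGroup)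
      hence "q (N #>\<^bsub>A\<^esub> x) Y = 1" using triv by blast
      thus ?thesis using q[OF that y(1)] y(2) by simp
    qed
    hence "y \<in> L" using y(1) unfolding L by simp
    thus "Y = \<one>\<^bsub>B Mod L\<^esub>" using y L.rcos_const[OF B] by simp
  qed
  thus ?thesis
    using fin bimultiplicative_factor_comm_group(2)[OF p A N]
      bimultiplicative_factor_comm_group(2)[OF bimultiplicative_swap[OF p] B L]
    by (intro perfect_pairing_iso) (auto simp: carrier_FactGroup)
qed

section \<open>Dual pairings of groups\<close>

definition dual_pairing ::
  "('a, 'm) monoid_scheme \<Rightarrow> ('b, 'k) monoid_scheme \<Rightarrow> ('a \<Rightarrow> 'b \<Rightarrow> complex) \<Rightarrow> bool" where
  "dual_pairing G H w \<longleftrightarrow>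
     (\<forall>k\<in>carrier H. normalized_irreducible_character G (\<lambda>x. w x k)) \<and>
     (\<forall>x\<in>carrier G. normalized_irreducible_character H (\<lambda>k. w x k)) \<and>
     (\<forall>f. normalized_irreducible_character G f \<longrightarrow> (\<exists>k\<in>carrier H. \<forall>x\<in>carrier G. f x = w x k)) \<and>
     (\<forall>f. normalized_irreducible_character H f \<longrightarrow> (\<exists>x\<in>carrier G. \<forall>k\<in>carrier H. f k = w x k))"

lemma conjugacy_class_cover:
  assumes G: "group G"
  shows "\<Union> (conjugacy_classes G) = carrier G" "C \<in> conjugacy_classes G \<Longrightarrow> C \<noteq> {}"
proof -
  interpret group G by fact
  have mem: "x \<in> orbit G (\<lambda>g. \<lambda>h\<in>carrier G. g \<otimes>\<^bsub>G\<^esub> h \<otimes>\<^bsub>G\<^esub> inv\<^bsub>G\<^esub> g) x" if "x \<in> carrier G" for x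
    unfolding orbit_def using that by (auto intro!: exI[of _ "\<one>\<^bsub>G\<^esub>"])
  have sub: "orbit G (\<lambda>g. \<lambda>h\<in>carrier G. g \<otimes>\<^bsub>G\<^esub> h \<otimes>\<^bsub>G\<^esub> inv\<^bsub>G\<^esub> g) x \<subseteq> carrier G" if "x \<in> carrier G" for x
    unfolding orbit_def using that by auto
  show "\<Union> (conjugacy_classes G) = carrier G"
    unfolding conjugacy_classes_def orbits_def using mem sub by blast
  show "C \<noteq> {}" if "C \<in> conjugacy_classes G"
    using that mem unfolding conjugacy_classes_def orbits_def by blast
qed

text \<open>The entries of \<open>Y = (D\<inverse> X N)\<^sup>T\<close> satisfy \<open>d\<^sub>i Y\<^sub>j\<^sub>i = X\<^sub>i\<^sub>j n\<^sub>j\<close>, that is, \<open>\<chi>\<^sub>i(x) / \<chi>\<^sub>i(1) = \<psi>\<^sub>j(k) / \<psi>\<^sub>j(1)\<close>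
  for \<open>x\<close> in the \<open>j\<close>-th class of \<open>G\<close> and \<open>k\<close> in the \<open>i\<close>-th class of \<open>H\<close>. The common value is \<open>w x k\<close>.\<close>
lemma transpose_group_dual_pairing:
  assumes G: "group G" and tr: "is_transpose_group G H"
  obtains w where "dual_pairing G H w"
proof -
  have H: "group H" using tr by (simp add: is_transpose_group_def)
  obtain \<chi>s Cs X \<psi>s Ks Y d n where
    tabG: "character_table G \<chi>s Cs X" and tabH: "character_table H \<psi>s Ks Y" and
    d: "\<forall>i<length \<chi>s. of_nat (d i) = (\<chi>s ! i) \<one>\<^bsub>G\<^esub>" and
    n: "\<forall>j<length \<psi>s. of_nat (n j) = (\<psi>s ! j) \<one>\<^bsub>H\<^esub>" and
    D: "mat_diag (dim_row X) (\<lambda>i. of_nat (d i)) \<in> Units (ring_mat TYPE(complex) (dim_row X) ())" and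
    Y: "Y = transpose_mat (inv\<^bsub>ring_mat TYPE(complex) (dim_row X) ()\<^esub> (mat_diag (dim_row X) (\<lambda>i. of_nat (d i)))
      * X * mat_diag (dim_col X) (\<lambda>j. of_nat (n j)))"
    using tr unfolding is_transpose_group_def Let_def by blast
  define r where "r = length \<chi>s"
  define c where "c = length Cs"
  have X: "X \<in> carrier_mat r c" using tabG by (simp add: character_table_def r_def c_def)
  define M where "M = ring_mat TYPE(complex) r ()"
  interpret M: ring M unfolding M_def by (rule ring_mat)
  define Dm where "Dm = mat_diag r (\<lambda>i. of_nat (d i) :: complex)"
  define Nm where "Nm = mat_diag c (\<lambda>j. of_nat (n j) :: complex)"
  define I where "I = inv\<^bsub>M\<^esub> Dm"
  have DU: "Dm \<in> Units M" using D X by (simp add: M_def Dm_def)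
  have I: "I \<in> carrier_mat r r" using M.Units_inv_closed[OF DU] by (simp add: I_def M_def ring_mat_simps)
  have DI: "Dm * I = 1\<^sub>m r" using M.Units_r_inv[OF DU] by (simp add: I_def M_def ring_mat_simps)
  have Dc: "Dm \<in> carrier_mat r r" and Nc: "Nm \<in> carrier_mat c c" by (simp_all add: Dm_def Nm_def)
  have YT: "Y = transpose_mat (I * X * Nm)" using Y X by (simp add: I_def M_def Dm_def Nm_def)
  have "Y \<in> carrier_mat c r" unfolding YT using I X Nc by simp
  hence len: "length \<psi>s = c" "length Ks = r"
    using tabH by (auto simp: character_table_def)
  have "Dm * transpose_mat Y = Dm * (I * X * Nm)" by (simp add: YT)
  also have "\<dots> = (Dm * I) * X * Nm"
    using Dc I X Nc by (simp add: assoc_mult_mat[of _ r r _ r _ c] assoc_mult_mat[of _ r r _ c _ c])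
  also have "\<dots> = X * Nm" unfolding DI using X by simp
  finally have mat_eq: "Dm * transpose_mat Y = X * Nm" .
  have entry: "of_nat (d i) * Y $$ (j,i) = X $$ (i,j) * of_nat (n j)" if ij: "i < r" "j < c" for i j
  proof -
    have "(Dm * transpose_mat Y) $$ (i,j) = of_nat (d i) * Y $$ (j,i)"
      using \<open>Y \<in> carrier_mat c r\<close> ij by (simp add: Dm_def mat_diag_mult_left[of _ r c])
    moreover have "(X * Nm) $$ (i,j) = X $$ (i,j) * of_nat (n j)"
      using X ij by (simp add: Nm_def mat_diag_mult_right[of _ r c])
    ultimately show ?thesis using mat_eq by simp
  qed
  have chi: "\<chi>s ! i \<in> irreducible_characters G" if "i < r" for i
    using tabG that by (auto simp: character_table_def r_def dest: nth_mem)
  have psi: "\<psi>s ! j \<in> irreducible_characters H" if "j < c" for j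
    using tabH that len by (auto simp: character_table_def dest: nth_mem)
  have chi1: "(\<chi>s ! i) \<one>\<^bsub>G\<^esub> \<noteq> 0" if "i < r" for i using irreducible_character_degree[OF G chi[OF that]] .
  have psi1: "(\<psi>s ! j) \<one>\<^bsub>H\<^esub> \<noteq> 0" if "j < c" for j using irreducible_character_degree[OF H psi[OF that]] .
  have key: "(\<chi>s ! i) x / (\<chi>s ! i) \<one>\<^bsub>G\<^esub> = (\<psi>s ! j) k / (\<psi>s ! j) \<one>\<^bsub>H\<^esub>"
    if "i < r" "j < c" "x \<in> Cs ! j" "k \<in> Ks ! i" for i j x k
  proof -
    have "X $$ (i,j) = (\<chi>s ! i) x" using tabG that by (simp add: character_table_def r_def c_def)
    moreover have "Y $$ (j,i) = (\<psi>s ! j) k" using tabH that len by (simp add: character_table_def)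
    moreover have "of_nat (d i) = (\<chi>s ! i) \<one>\<^bsub>G\<^esub>" "of_nat (n j) = (\<psi>s ! j) \<one>\<^bsub>H\<^esub>"
      using d n that len by (simp_all add: r_def)
    ultimately have "(\<chi>s ! i) \<one>\<^bsub>G\<^esub> * (\<psi>s ! j) k = (\<chi>s ! i) x * (\<psi>s ! j) \<one>\<^bsub>H\<^esub>"
      using entry[OF that(1,2)] by simp
    thus ?thesis using chi1[OF that(1)] psi1[OF that(2)] by (simp add: field_simps)
  qed
  have Cs: "set Cs = conjugacy_classes G" and Ks: "set Ks = conjugacy_classes H"
    using tabG tabH by (simp_all add: character_table_def)
  have colG: "\<exists>j<c. x \<in> Cs ! j" if "x \<in> carrier G" for x
  proof -
    have "x \<in> \<Union> (set Cs)" using that conjugacy_class_cover(1)[OF G] Cs by simp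
    thus ?thesis by (auto simp: in_set_conv_nth c_def)
  qed
  have colH: "\<exists>i<r. k \<in> Ks ! i" if "k \<in> carrier H" for k
  proof -
    have "k \<in> \<Union> (set Ks)" using that conjugacy_class_cover(1)[OF H] Ks by simp
    thus ?thesis using len by (auto simp: in_set_conv_nth)
  qed
  have repG: "\<exists>x\<in>carrier G. x \<in> Cs ! j" if "j < c" for j
  proof -
    have "Cs ! j \<in> conjugacy_classes G" using that Cs by (auto simp: c_def dest: nth_mem)
    thus ?thesis using conjugacy_class_cover[OF G] by blast
  qed
  have repH: "\<exists>k\<in>carrier H. k \<in> Ks ! i" if "i < r" for i
  proof -
    have "Ks ! i \<in> conjugacy_classes H" using that Ks len by (auto dest: nth_mem)
    thus ?thesis using conjugacy_class_cover[OF H] by blast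
  qed
  \<comment> \<open>A class index for \<open>k\<close>; by \<open>key\<close> any other choice gives the same function \<open>w\<close>.\<close>
  define row where "row k = (SOME i. i < r \<and> k \<in> Ks ! i)" for k
  define w where "w x k = (\<chi>s ! row k) x / (\<chi>s ! row k) \<one>\<^bsub>G\<^esub>" for x k
  have row: "row k < r" "k \<in> Ks ! row k" if "k \<in> carrier H" for k
    using someI_ex[of "\<lambda>i. i < r \<and> k \<in> Ks ! i"] colH[OF that] unfolding row_def by auto
  have w_psi: "w x k = (\<psi>s ! j) k / (\<psi>s ! j) \<one>\<^bsub>H\<^esub>" if "k \<in> carrier H" "j < c" "x \<in> Cs ! j" for x k j
    unfolding w_def by (rule key[OF row(1)[OF that(1)] that(2,3) row(2)[OF that(1)]])
  have w_chi: "w x k = (\<chi>s ! i) x / (\<chi>s ! i) \<one>\<^bsub>G\<^esub>"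
    if "x \<in> carrier G" "k \<in> carrier H" "i < r" "k \<in> Ks ! i" for x k i
  proof -
    obtain j where "j < c" "x \<in> Cs ! j" using colG \<open>x \<in> carrier G\<close> by blast
    thus ?thesis using w_psi key that by simp
  qed
  have "dual_pairing G H w"
    unfolding dual_pairing_def
  proof (intro conjI ballI allI impI)
    fix k assume "k \<in> carrier H"
    thus "normalized_irreducible_character G (\<lambda>x. w x k)"
      using chi chi1 row unfolding normalized_irreducible_character_def w_def by blast
  next
    fix x assume "x \<in> carrier G"
    then obtain j where "j < c" "x \<in> Cs ! j" using colG by blast
    thus "normalized_irreducible_character H (\<lambda>k. w x k)"
      using psi psi1 w_psi unfolding normalized_irreducible_character_def by blast
  next
    fix f assume "normalized_irreducible_character G f"
    then obtain \<chi> where \<chi>: "\<chi> \<in> irreducible_characters G" "\<forall>x\<in>carrier G. f x = \<chi> x / \<chi> \<one>\<^bsub>G\<^esub>"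
      by (auto simp: normalized_irreducible_character_def)
    have "\<chi> \<in> set \<chi>s" using \<chi>(1) tabG by (simp add: character_table_def)
    then obtain i where i: "i < r" "\<chi> = \<chi>s ! i"
      by (auto simp: r_def in_set_conv_nth)
    obtain k where k: "k \<in> carrier H" "k \<in> Ks ! i" using repH[OF i(1)] by blast
    have "\<forall>x\<in>carrier G. f x = w x k" using \<chi>(2) w_chi[OF _ k(1) i(1) k(2)] i(2) by simp
    thus "\<exists>k\<in>carrier H. \<forall>x\<in>carrier G. f x = w x k" using k(1) by blast
  next
    fix f assume "normalized_irreducible_character H f"
    then obtain \<psi> where \<psi>: "\<psi> \<in> irreducible_characters H" "\<forall>k\<in>carrier H. f k = \<psi> k / \<psi> \<one>\<^bsub>H\<^esub>"
      by (auto simp: normalized_irreducible_character_def)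
    have "\<psi> \<in> set \<psi>s" using \<psi>(1) tabH by (simp add: character_table_def)
    then obtain j where j: "j < c" "\<psi> = \<psi>s ! j"
      using len by (auto simp: in_set_conv_nth)
    obtain x where x: "x \<in> carrier G" "x \<in> Cs ! j" using repG[OF j(1)] by blast
    have "\<forall>k\<in>carrier H. f k = w x k" using \<psi>(2) w_psi[OF _ j(1) x(2)] j(2) by simp
    thus "\<exists>x\<in>carrier G. \<forall>k\<in>carrier H. f k = w x k" using x(1) by blast
  qed
  thus ?thesis by (rule that)
qed

lemma commutator_subgroup_normal:
  assumes G: "group G" and K: "K \<lhd> G"
  shows "commutator_subgroup G K (carrier G) \<lhd> G" "commutator_subgroup G K (carrier G) \<subseteq> K"
    "k \<in> K \<Longrightarrow> g \<in> carrier G \<Longrightarrow> group.commutator G k g \<in> commutator_subgroup G K (carrier G)"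
proof -
  interpret group G by fact
  interpret K: normal K G by fact
  let ?S = "\<Union>a\<in>K. \<Union>b\<in>carrier G. {commutator a b}"
  have comm_K: "commutator a b \<in> K" if "a \<in> K" "b \<in> carrier G" for a b
  proof -
    have "commutator a b = a \<otimes>\<^bsub>G\<^esub> (b \<otimes>\<^bsub>G\<^esub> inv\<^bsub>G\<^esub> a \<otimes>\<^bsub>G\<^esub> inv\<^bsub>G\<^esub> b)" using that by (simp add: m_assoc)
    also have "\<dots> \<in> K" using that K.inv_op_closed2 by simp
    finally show ?thesis .
  qed
  show "commutator_subgroup G K (carrier G) \<lhd> G"
    unfolding commutator_subgroup_def
  proof (rule normal_generateI)
    show "?S \<subseteq> carrier G" using comm_K by auto
    fix h g assume "h \<in> ?S" and g: "g \<in> carrier G"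
    then obtain a b where ab: "a \<in> K" "b \<in> carrier G" "h = commutator a b" by auto
    have a: "a \<in> carrier G" using ab by simp
    have "g \<otimes>\<^bsub>G\<^esub> h \<otimes>\<^bsub>G\<^esub> inv\<^bsub>G\<^esub> g = commutator (g \<otimes>\<^bsub>G\<^esub> a \<otimes>\<^bsub>G\<^esub> inv\<^bsub>G\<^esub> g) (g \<otimes>\<^bsub>G\<^esub> b \<otimes>\<^bsub>G\<^esub> inv\<^bsub>G\<^esub> g)"
    proof -
      have cancel: "inv\<^bsub>G\<^esub> g \<otimes>\<^bsub>G\<^esub> (g \<otimes>\<^bsub>G\<^esub> z) = z" if "z \<in> carrier G" for z
        using g that by (simp flip: m_assoc)
      show ?thesis
        using a ab(2) g by (simp add: ab(3) inv_mult_group m_assoc cancel)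
    qed
    moreover have "g \<otimes>\<^bsub>G\<^esub> a \<otimes>\<^bsub>G\<^esub> inv\<^bsub>G\<^esub> g \<in> K" using K.inv_op_closed2[OF g ab(1)] .
    moreover have "g \<otimes>\<^bsub>G\<^esub> b \<otimes>\<^bsub>G\<^esub> inv\<^bsub>G\<^esub> g \<in> carrier G" using g ab(2) by simp
    ultimately show "g \<otimes>\<^bsub>G\<^esub> h \<otimes>\<^bsub>G\<^esub> inv\<^bsub>G\<^esub> g \<in> ?S"
      by (intro UN_I) (simp_all only: singleton_iff)
  qed
  show "commutator_subgroup G K (carrier G) \<subseteq> K"
    unfolding commutator_subgroup_def
    by (rule generate_subgroup_incl[OF _ K.subgroup_axioms]) (use comm_K in auto)
  show "commutator k g \<in> commutator_subgroup G K (carrier G)" if "k \<in> K" "g \<in> carrier G"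
    unfolding commutator_subgroup_def using that by (intro generate.incl) blast
qed

lemma upper_central_Suc_commutators:
  assumes G: "group G" and Z: "upper_central G i \<lhd> G"
  shows "upper_central G (Suc i) = {x \<in> carrier G. \<forall>g\<in>carrier G. group.commutator G x g \<in> upper_central G i}"
proof -
  interpret group G by fact
  define Z where "Z = upper_central G i"
  interpret Z: normal Z G unfolding Z_def by fact
  have "(Z #>\<^bsub>G\<^esub> x) <#>\<^bsub>G\<^esub> (Z #>\<^bsub>G\<^esub> g) = (Z #>\<^bsub>G\<^esub> g) <#>\<^bsub>G\<^esub> (Z #>\<^bsub>G\<^esub> x) \<longleftrightarrow> commutator x g \<in> Z"
    if "x \<in> carrier G" "g \<in> carrier G" for x g
  proof -
    have "commutator x g = (x \<otimes>\<^bsub>G\<^esub> g) \<otimes>\<^bsub>G\<^esub> inv\<^bsub>G\<^esub> (g \<otimes>\<^bsub>G\<^esub> x)" using that by (simp add: inv_mult_group m_assoc)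
    hence "commutator x g \<in> Z \<longleftrightarrow> x \<otimes>\<^bsub>G\<^esub> g \<in> Z #>\<^bsub>G\<^esub> (g \<otimes>\<^bsub>G\<^esub> x)"
      using Z.rcos_module[OF G, of "g \<otimes>\<^bsub>G\<^esub> x" "x \<otimes>\<^bsub>G\<^esub> g"] that by simp
    also have "\<dots> \<longleftrightarrow> Z #>\<^bsub>G\<^esub> (x \<otimes>\<^bsub>G\<^esub> g) = Z #>\<^bsub>G\<^esub> (g \<otimes>\<^bsub>G\<^esub> x)"
      using repr_independence[OF _ _ Z.subgroup_axioms] rcos_self[OF _ Z.subgroup_axioms] that by (metis m_closed)
    finally show ?thesis using that by (simp add: Z.rcos_sum)
  qed
  thus ?thesis
    by (auto simp: group_center_def carrier_FactGroup simp flip: Z_def)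
qed

text \<open>Here \<open>M / N\<close> is the center of \<open>G / N\<close>. The first claim describes \<open>M\<close> by a condition that is symmetric
  in both groups, and reading that condition in \<open>H\<close> gives the second one. That \<open>N\<close> and \<open>L\<close>
  are equal to their double annihilators is the separation of normal subgroups by irreducible
  characters.\<close>
lemma dual_pairing_central_step:
  fixes G :: "('a, 'm) monoid_scheme" and H :: "('b, 'k) monoid_scheme"
  assumes G: "group G" and H: "group H" and fin: "finite (carrier G)" "finite (carrier H)"
    and dual: "dual_pairing G H w" and N: "N \<lhd> G" and K: "K \<lhd> H"
    and K_eq: "K = {k \<in> carrier H. \<forall>x\<in>N. w x k = 1}"
    and M_eq: "M = {x \<in> carrier G. \<forall>g\<in>carrier G. group.commutator G x g \<in> N}"
    and L_eq: "L = commutator_subgroup H K (carrier H)"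
  shows "\<And>x. x \<in> carrier G \<Longrightarrow> x \<in> M \<longleftrightarrow> (\<forall>k\<in>K. cmod (w x k) = 1)"
    and "M = {x \<in> carrier G. \<forall>k\<in>L. w x k = 1}"
    and "L = {k \<in> carrier H. \<forall>x\<in>M. w x k = 1}"
    and "N = {x \<in> carrier G. \<forall>k\<in>K. w x k = 1}"
    and "M \<lhd> G"
proof -
  interpret G: group G by fact
  interpret H: group H by fact
  interpret N: normal N G by fact
  interpret K: normal K H by fact
  have nG: "normalized_irreducible_character G (\<lambda>x. w x k)" if "k \<in> carrier H" for k
    using dual that by (simp add: dual_pairing_def)
  have nH: "normalized_irreducible_character H (\<lambda>k. w x k)" if "x \<in> carrier G" for x
    using dual that by (simp add: dual_pairing_def)
  have extG: "cmod (w x k) = 1 \<longleftrightarrow> (\<forall>g\<in>carrier G. w (G.commutator x g) k = 1)"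
    if x: "x \<in> carrier G" and k: "k \<in> carrier H" for x k
  proof -
    obtain n \<rho> where "normalized_character G n \<rho> (\<lambda>x. w x k)"
      using normalized_irreducible_character_locale[OF G fin(1) nG[OF k]] .
    from normalized_character.extremal_iff_commutators[OF this x] show ?thesis by blast
  qed
  have extH: "cmod (w x k) = 1 \<longleftrightarrow> (\<forall>h\<in>carrier H. w x (H.commutator k h) = 1)"
    if x: "x \<in> carrier G" and k: "k \<in> carrier H" for x k
  proof -
    obtain n \<rho> where "normalized_character H n \<rho> (\<lambda>k. w x k)"
      using normalized_irreducible_character_locale[OF H fin(2) nH[OF x]] .
    from normalized_character.extremal_iff_commutators[OF this k] show ?thesis by blast
  qed
  show N_eq: "N = {x \<in> carrier G. \<forall>k\<in>K. w x k = 1}"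
  proof (intro equalityI subsetI)
    fix x assume x: "x \<in> {x \<in> carrier G. \<forall>k\<in>K. w x k = 1}"
    show "x \<in> N"
    proof (rule ccontr)
      assume "x \<notin> N"
      then obtain f where f: "normalized_irreducible_character G f" "\<And>y. y \<in> N \<Longrightarrow> f y = 1" "f x \<noteq> 1"
        using normalized_irreducible_character_separates[OF G fin(1) N, of x] x by blast
      then obtain k where k: "k \<in> carrier H" "\<forall>x\<in>carrier G. f x = w x k"
        using dual unfolding dual_pairing_def by blast
      have "w y k = 1" if "y \<in> N" for y
        using bspec[OF k(2) N.mem_carrier[OF that]] f(2)[OF that] by simp
      hence "k \<in> K" unfolding K_eq using k(1) by blast
      thus False using x k f(3) by auto
    qed
  next
    fix x assume x: "x \<in> N"
    thus "x \<in> {x \<in> carrier G. \<forall>k\<in>K. w x k = 1}" unfolding K_eq by simp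
  qed
  show M_iff: "x \<in> M \<longleftrightarrow> (\<forall>k\<in>K. cmod (w x k) = 1)" if x: "x \<in> carrier G" for x
  proof -
    have "x \<in> M \<longleftrightarrow> (\<forall>k\<in>K. \<forall>g\<in>carrier G. w (G.commutator x g) k = 1)"
      using x by (subst M_eq, subst N_eq) auto
    thus ?thesis using extG[OF x] K.subset by blast
  qed
  note L = commutator_subgroup_normal[OF H K, folded L_eq]
  interpret L: normal L H by (rule L)
  show M_eq_perp: "M = {x \<in> carrier G. \<forall>k\<in>L. w x k = 1}"
  proof (intro equalityI subsetI)
    fix x assume xM: "x \<in> M"
    hence x: "x \<in> carrier G" by (simp add: M_eq)
    have "{k \<in> carrier H. \<forall>f\<in>{\<lambda>k. w x k}. f k = 1} \<lhd> H"
      by (rule common_kernel_normal[OF H fin(2)]) (use nH[OF x] in auto)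
    hence "subgroup {k \<in> carrier H. w x k = 1} H" by (simp add: normal_imp_subgroup)
    moreover have "(\<Union>a\<in>K. \<Union>b\<in>carrier H. {H.commutator a b}) \<subseteq> {k \<in> carrier H. w x k = 1}"
      using M_iff[OF x] extH[OF x] xM K.subset by auto
    ultimately have "L \<subseteq> {k \<in> carrier H. w x k = 1}"
      unfolding L_eq commutator_subgroup_def by (rule H.generate_subgroup_incl[rotated])
    thus "x \<in> {x \<in> carrier G. \<forall>k\<in>L. w x k = 1}" using x by auto
  next
    fix x assume "x \<in> {x \<in> carrier G. \<forall>k\<in>L. w x k = 1}"
    hence x: "x \<in> carrier G" and "\<And>k. k \<in> L \<Longrightarrow> w x k = 1" by auto
    hence "cmod (w x k) = 1" if "k \<in> K" for k using extH[OF x] K.subset L(3) that by auto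
    thus "x \<in> M" using M_iff[OF x] by blast
  qed
  show "L = {k \<in> carrier H. \<forall>x\<in>M. w x k = 1}"
  proof (intro equalityI subsetI)
    fix k assume "k \<in> L"
    thus "k \<in> {k \<in> carrier H. \<forall>x\<in>M. w x k = 1}" using M_eq_perp by auto
  next
    fix k assume k: "k \<in> {k \<in> carrier H. \<forall>x\<in>M. w x k = 1}"
    show "k \<in> L"
    proof (rule ccontr)
      assume "k \<notin> L"
      then obtain f where f: "normalized_irreducible_character H f" "\<And>y. y \<in> L \<Longrightarrow> f y = 1" "f k \<noteq> 1"
        using normalized_irreducible_character_separates[OF H fin(2) L(1), of k] k by blast
      then obtain x where x: "x \<in> carrier G" "\<forall>k\<in>carrier H. f k = w x k"
        using dual unfolding dual_pairing_def by blast
      have "x \<in> M" using x f(2) L.subset by (subst M_eq_perp) auto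
      thus False using x k f(3) by auto
    qed
  qed
  have "{x \<in> carrier G. \<forall>f\<in>(\<lambda>k x. w x k) ` L. f x = 1} \<lhd> G"
    by (rule common_kernel_normal[OF G fin(1)]) (use nG L.subset in auto)
  thus "M \<lhd> G" unfolding M_eq_perp by simp
qed

lemma dual_pairing_central_series:
  assumes G: "group G" and H: "group H" and fin: "finite (carrier G)" "finite (carrier H)"
    and dual: "dual_pairing G H w"
  shows "upper_central G i \<lhd> G \<and> lower_central H (Suc i) \<lhd> H \<and>
    lower_central H (Suc i) = {k \<in> carrier H. \<forall>x\<in>upper_central G i. w x k = 1}"
proof (induction i)
  case 0
  interpret G: group G by fact
  interpret H: group H by fact
  have "w \<one>\<^bsub>G\<^esub> k = 1" if k: "k \<in> carrier H" for k
  proof -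
    have "normalized_irreducible_character G (\<lambda>x. w x k)" using dual k by (simp add: dual_pairing_def)
    then obtain n \<rho> where "normalized_character G n \<rho> (\<lambda>x. w x k)"
      using normalized_irreducible_character_locale[OF G fin(1)] by blast
    from normalized_character.f_one[OF this] show ?thesis .
  qed
  thus ?case using G.one_is_normal H.normal_invI[OF H.subgroup_self] by auto
next
  case (Suc i)
  from Suc.IH have Z: "upper_central G i \<lhd> G" and \<gamma>: "lower_central H (Suc i) \<lhd> H"
    and perp: "lower_central H (Suc i) = {k \<in> carrier H. \<forall>x\<in>upper_central G i. w x k = 1}"
    by blast+
  note step = dual_pairing_central_step[OF G H fin dual Z \<gamma> perp
      upper_central_Suc_commutators[OF G Z] lower_central.simps(3)]
  have "lower_central H (Suc (Suc i)) \<lhd> H"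
    unfolding lower_central.simps(3) by (rule commutator_subgroup_normal(1)[OF H \<gamma>])
  with step(3,5) show ?case by blast
qed

lemma dual_pairing_central_factors:
  assumes G: "group G" and H: "group H" and fin: "finite (carrier G)" "finite (carrier H)"
    and dual: "dual_pairing G H w"
  shows "comm_group (upper_central_factor G (Suc i)) \<and> comm_group (lower_central_factor H (Suc i)) \<and>
    upper_central_factor G (Suc i) \<cong> lower_central_factor H (Suc i)"
proof -
  interpret G: group G by fact
  interpret H: group H by fact
  define N where "N = upper_central G i"
  define K where "K = lower_central H (Suc i)"
  define M where "M = upper_central G (Suc i)"
  define L where "L = lower_central H (Suc (Suc i))"
  have ser: "N \<lhd> G" "K \<lhd> H" "K = {k \<in> carrier H. \<forall>x\<in>N. w x k = 1}"
    using dual_pairing_central_series[OF assms, of i] by (auto simp: N_def K_def)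
  have M_eq: "M = {x \<in> carrier G. \<forall>g\<in>carrier G. G.commutator x g \<in> N}"
    unfolding M_def N_def using upper_central_Suc_commutators[OF G, of i] ser(1) by (simp add: N_def)
  have L_eq: "L = commutator_subgroup H K (carrier H)" by (simp add: L_def K_def)
  note step = dual_pairing_central_step[OF G H fin dual ser M_eq L_eq]
  have MG: "subgroup M G" and KH: "subgroup K H"
    using step(5) ser(2) by (auto simp: normal_imp_subgroup)
  have Mc: "M \<subseteq> carrier G" and Kc: "K \<subseteq> carrier H" using MG KH by (auto simp: subgroup.subset)
  have LK: "L \<subseteq> K" using commutator_subgroup_normal(2)[OF H ser(2)] L_eq by simp
  have NM: "N \<subseteq> M" using LK step(4) unfolding step(2) by blast
  define A where "A = G\<lparr>carrier := M\<rparr>"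
  define B where "B = H\<lparr>carrier := K\<rparr>"
  have A: "group A" and B: "group B"
    unfolding A_def B_def using G.subgroup_imp_group[OF MG] H.subgroup_imp_group[OF KH] .
  have norm1: "cmod (w x k) = 1" if "x \<in> M" "k \<in> K" for x k
    using step(1)[of x] that Mc by blast
  have bi: "bimultiplicative A B w"
    unfolding bimultiplicative_def
  proof (intro conjI ballI)
    fix x k assume "x \<in> carrier A" "k \<in> carrier B"
    hence "cmod (w x k) = 1" using norm1 by (simp add: A_def B_def)
    thus "w x k \<noteq> 0" by auto
  next
    fix x y k assume "x \<in> carrier A" "y \<in> carrier A" "k \<in> carrier B"
    hence xyk: "x \<in> M" "y \<in> M" "k \<in> K" by (auto simp: A_def B_def)
    have "normalized_irreducible_character G (\<lambda>x. w x k)" using dual xyk Kc by (auto simp: dual_pairing_def)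
    then obtain n \<rho> where "normalized_character G n \<rho> (\<lambda>x. w x k)"
      using normalized_irreducible_character_locale[OF G fin(1)] by blast
    from normalized_character.f_mult[OF this, of x y] show "w (x \<otimes>\<^bsub>A\<^esub> y) k = w x k * w y k"
      using xyk Mc norm1 by (auto simp: A_def)
  next
    fix x k l assume "x \<in> carrier A" "k \<in> carrier B" "l \<in> carrier B"
    hence xkl: "x \<in> M" "k \<in> K" "l \<in> K" by (auto simp: A_def B_def)
    have "normalized_irreducible_character H (\<lambda>k. w x k)" using dual xkl Mc by (auto simp: dual_pairing_def)
    then obtain n \<rho> where "normalized_character H n \<rho> (\<lambda>k. w x k)"
      using normalized_irreducible_character_locale[OF H fin(2)] by blast
    from normalized_character.f_mult[OF this, of k l] show "w x (k \<otimes>\<^bsub>B\<^esub> l) = w x k * w x l"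
      using xkl Kc norm1 by (auto simp: B_def)
  qed
  have NA: "N = {x \<in> carrier A. \<forall>k\<in>carrier B. w x k = 1}"
    using step(4) NM Mc unfolding A_def B_def by auto
  have LB: "L = {k \<in> carrier B. \<forall>x\<in>carrier A. w x k = 1}"
    using step(3) LK Kc unfolding A_def B_def by auto
  have "finite (carrier A)" "finite (carrier B)"
    using fin Mc Kc finite_subset by (auto simp: A_def B_def)
  hence "A Mod N \<cong> B Mod L" by (rule bimultiplicative_factor_iso[OF bi A B _ _ NA LB])
  moreover have "comm_group (A Mod N)" by (rule bimultiplicative_factor_comm_group(2)[OF bi A NA])
  moreover have "comm_group (B Mod L)"
    by (rule bimultiplicative_factor_comm_group(2)[OF bimultiplicative_swap[OF bi] B LB])
  moreover have "upper_central_factor G (Suc i) = A Mod N"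
    by (simp add: upper_central_factor_def A_def N_def M_def)
  moreover have "lower_central_factor H (Suc i) = B Mod L"
    by (simp add: lower_central_factor_def B_def K_def L_def)
  ultimately show ?thesis by simp
qed

theorem theorem3p7:
  fixes G :: "('a, 'm) monoid_scheme" and GT :: "('b, 'k) monoid_scheme"
  assumes "group G" and "finite (carrier G)"
    and "transposable G"
    and "is_transpose_group G GT"
  shows "\<forall>i\<ge>1. comm_group (upper_central_factor G i) \<and>
               comm_group (lower_central_factor GT i) \<and>
               upper_central_factor G i \<cong> lower_central_factor GT i"
proof (intro allI impI)
  fix i :: nat assume "i \<ge> 1"
  then obtain j where i: "i = Suc j" by (cases i) auto
  have GT: "group GT" "finite (carrier GT)" using assms(4) by (simp_all add: is_transpose_group_def)
  obtain w where "dual_pairing G GT w"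
    using transpose_group_dual_pairing[OF assms(1,4)] .
  from dual_pairing_central_factors[OF assms(1) GT(1) assms(2) GT(2) this]
  show "comm_group (upper_central_factor G i) \<and> comm_group (lower_central_factor GT i) \<and>
    upper_central_factor G i \<cong> lower_central_factor GT i"
    unfolding i .
qed

end
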